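(* Let $m\ge2$ be an integer, $\alpha\in[0,1)$, $u=\frac{\alpha}{1-\alpha}$, $\psi=\frac1{1+2u}$ and $a=m+2mu$. Let $(G_n)$ be any of the three versions (independent, conditional, sequential) of the preferential attachment graph with parameters $m,\alpha$. Let $v_0$ be a uniformly chosen vertex in $G_n$, let $D$ be the degree of $v_0$, and let $D'$ be the degree of a vertex chosen uniformly at random from the $m$ vertices which received an edge from $v_0$. Then, as $n\to\infty$, the distributions of $D$ and $D'$ converge to the distributions given, for $k=0,1,2,\ldots$, by $$\mathbf P(D=m+k)=\frac{\psi+1}{\psi}\,\frac{\Gamma(a+1/\psi+1)}{\Gamma(a)}\,\frac{\Gamma(k+a)}{\Gamma(a+1/\psi+k+2)}$$ and $$\mathbf P(D'=m+1+k)=\frac{\psi+1}{\psi^2}\,\frac{\Gamma(a+1/\psi+1)}{\Gamma(a+1)}\,\frac{(k+1)\Gamma(k+a+1)}{\Gamma(a+1/\psi+k+3)},$$ respectively. As $k\to\infty$, these limiting distributions satisfy $$\mathbf P(D=m+k)=Ck^{-2-1/\psi}\bigl(1+O(k^{-1})\bigr),\qquad \mathbf P(D'=m+1+k)=\tilde C k^{-1-1/\psi}\bigl(1+O(k^{-1})\bigr)$$ for some constants $C$ and $\tilde C$ depending on $m$ and $\alpha$.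
   Context: In the formulas, $\Gamma(\cdot)$ is Euler's Gamma function. Degrees count edge multiplicities. Preferential attachment graphs. $G_1$ is a single vertex $1$ with no edges; $G_2$ has vertices $1,2$ joined by $m$ edges. Given $G_{n-1}$ on $\{1,\ldots,n-1\}$, $G_n$ is obtained by adding the vertex $n$ and $m$ edges from $n$ to $w_1,\ldots,w_m\in\{1,\ldots,n-1\}$ (repetitions give multiple edges); $w_1,\ldots,w_m$ are the vertices which received an edge from $n$. Let $\deg_{n-1}(k)$ be the degree of $k$ in $G_{n-1}$. The choice of the $w_i$ is as follows. (1) Independent model: given $G_{n-1}$, the $w_i$ are i.i.d.; with probability $\alpha$, $w_i$ is uniform on $\{1,\ldots,n-1\}$, and with probability $1-\alpha$, $\mathbf P(w_i=k)=\deg_{n-1}(k)/Z$ with $Z=\sum_{k=1}^{n-1}\deg_{n-1}(k)=2m(n-2)$. (2) Conditional model: start from some predetermined graph structure on the first $m$ vertices (instead of $G_1,G_2$); for later vertices, $w_1,\ldots,w_m$ are chosen as in the independent rule ($Z$ being the sum of the degrees in $G_{n-1}$), conditioned on being pairwise distinct. (In particular vertex $m+1$ is joined to each of $1,\ldots,m$.) (3) Sequential model: the $w_i$ are chosen successively; given $G_{n-1}$ and $w_1,\ldots,w_{i-1}$, with probability $\tilde\alpha=\alpha\frac{2m(n-1)}{2m(n-2)+2m\alpha+(1-\alpha)(i-1)}$, $w_i$ is uniform on $\{1,\ldots,n-1\}$, and with probability $1-\tilde\alpha$, $\mathbf P(w_i=k)=\deg'_{n-1}(k)/Z'$, where $\deg'_{n-1}(k)=\deg_{n-1}(k)+\#\{1\le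 j\le i-1:w_j=k\}$ and $Z'=2m(n-2)+i-1$. The finitely many initial vertices of $G_n$ that do not send out $m$ edges (for which $D'$ is not defined) are chosen as $v_0$ with probability tending to $0$ and play no role in the limit; $D'$ may be assigned any value there. *)

theory Defs
  imports "HOL-Probability.Probability"
begin

text \<open>
  A graph on the vertices \<open>1, 2, \<dots>\<close> is given by its multiset of edges. An edge sent out by the
  vertex \<open>v\<close> to the older vertex \<open>w\<close> is stored as \<open>(v, w)\<close>; for the edges of an initial graph the
  order of the pair has no significance.
\<close>

type_synonym mgraph = "(nat \<times> nat) multiset"

text \<open>Every vertex occurs in \<open>endpoints G\<close> as often as its degree.\<close>

definition endpoints :: "mgraph \<Rightarrow> nat multiset" where
  "endpoints G = image_mset fst G + image_mset snd G"

definition deg :: "mgraph \<Rightarrow> nat \<Rightarrow> nat" where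
  "deg G k = count (endpoints G) k"

definition receivers :: "mgraph \<Rightarrow> nat \<Rightarrow> nat multiset" where
  "receivers G v = image_mset snd (filter_mset (\<lambda>e. fst e = v) G)"

text \<open>
  With probability \<open>q\<close> uniform on the vertices older than \<open>v\<close>; otherwise \<open>k\<close> is chosen with
  probability \<open>count E k / size E\<close>, that is \<open>deg G k / Z\<close> for \<open>E = endpoints G\<close>.
\<close>

definition pick :: "real \<Rightarrow> nat \<Rightarrow> nat multiset \<Rightarrow> nat pmf" where
  "pick q v E =
     bind_pmf (bernoulli_pmf q) (\<lambda>b. if b then pmf_of_set {1..<v} else pmf_of_multiset E)"

text \<open>
  The three rules below give the law of the list \<open>w\<^sub>1, \<dots>, w\<^sub>m\<close> of the vertices receiving an edge
  from the new vertex \<open>v\<close>, given the graph \<open>G\<close> on \<open>{1..<v}\<close>. The case \<open>v = 2\<close> of the independent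
  and the sequential rule is the prescribed graph on two vertices.
\<close>

definition indep_rule :: "nat \<Rightarrow> real \<Rightarrow> nat \<Rightarrow> mgraph \<Rightarrow> nat list pmf" where
  "indep_rule m \<alpha> v G =
     (if v = 2 then return_pmf (replicate m 1)
      else replicate_pmf m (pick \<alpha> v (endpoints G)))"

text \<open>
  Distinctness forces the vertex \<open>m + 1\<close> to be joined to each of \<open>1, \<dots>, m\<close> (the order of the list
  does not affect the graph). This is written out because the conditioning is ill-defined if, say,
  the initial graph has no edges. From \<open>v = m + 2\<close> on, the event has positive probability.
\<close>

definition cond_rule :: "nat \<Rightarrow> real \<Rightarrow> nat \<Rightarrow> mgraph \<Rightarrow> nat list pmf" where
  "cond_rule m \<alpha> v G =
     (if v = m + 1 then return_pmf [1..<m+1]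
      else cond_pmf (replicate_pmf m (pick \<alpha> v (endpoints G))) {ws. distinct ws})"

text \<open>Here \<open>i\<close> is the number of edges of \<open>v\<close> already placed.\<close>

definition seq_prob :: "nat \<Rightarrow> real \<Rightarrow> nat \<Rightarrow> nat \<Rightarrow> real" where
  "seq_prob m \<alpha> v i =
     \<alpha> * ((2 * real m * (real v - 1)) /
          (2 * real m * (real v - 2) + 2 * real m * \<alpha> + (1 - \<alpha>) * real i))"

primrec seq_choices :: "nat \<Rightarrow> real \<Rightarrow> nat \<Rightarrow> mgraph \<Rightarrow> nat \<Rightarrow> nat list pmf" where
  "seq_choices m \<alpha> v G 0 = return_pmf []"
| "seq_choices m \<alpha> v G (Suc i) =
     bind_pmf (seq_choices m \<alpha> v G i)
       (\<lambda>ws. map_pmf (\<lambda>w. ws @ [w]) (pick (seq_prob m \<alpha> v i) v (endpoints G + mset ws)))"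

definition seq_rule :: "nat \<Rightarrow> real \<Rightarrow> nat \<Rightarrow> mgraph \<Rightarrow> nat list pmf" where
  "seq_rule m \<alpha> v G =
     (if v = 2 then return_pmf (replicate m 1) else seq_choices m \<alpha> v G m)"

text \<open>
  \<open>grow s H rule n\<close> is the law of the graph on \<open>{1..n}\<close>, for \<open>n \<ge> s\<close>, when \<open>H\<close> is the initial
  graph on \<open>{1..s}\<close>. For \<open>n < s\<close> the value is irrelevant.
\<close>

primrec grow ::
  "nat \<Rightarrow> mgraph \<Rightarrow> (nat \<Rightarrow> mgraph \<Rightarrow> nat list pmf) \<Rightarrow> nat \<Rightarrow> mgraph pmf" where
  "grow s H rule 0 = return_pmf H"
| "grow s H rule (Suc n) =
     (if Suc n \<le> s then return_pmf H
      else bind_pmf (grow s H rule n)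
        (\<lambda>G. map_pmf (\<lambda>ws. G + image_mset (Pair (Suc n)) (mset ws)) (rule (Suc n) G)))"

text \<open>The argument of \<open>Conditional\<close> is the predetermined graph on the first \<open>m\<close> vertices.\<close>

datatype pa_model = Independent | Conditional mgraph | Sequential

fun valid_model :: "nat \<Rightarrow> pa_model \<Rightarrow> bool" where
  "valid_model m Independent = True"
| "valid_model m (Conditional H) = (set_mset H \<subseteq> {1..m} \<times> {1..m})"
| "valid_model m Sequential = True"

fun pa_graph :: "nat \<Rightarrow> real \<Rightarrow> pa_model \<Rightarrow> nat \<Rightarrow> mgraph pmf" where
  "pa_graph m \<alpha> Independent = grow 1 {#} (indep_rule m \<alpha>)"
| "pa_graph m \<alpha> (Conditional H) = grow m H (cond_rule m \<alpha>)"
| "pa_graph m \<alpha> Sequential = grow 1 {#} (seq_rule m \<alpha>)"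

text \<open>The vertices \<open>1, \<dots>, n_initial m M\<close> do not send out \<open>m\<close> edges.\<close>

fun n_initial :: "nat \<Rightarrow> pa_model \<Rightarrow> nat" where
  "n_initial m Independent = 1"
| "n_initial m (Conditional H) = m"
| "n_initial m Sequential = 1"

definition degree_law :: "nat \<Rightarrow> real \<Rightarrow> pa_model \<Rightarrow> nat \<Rightarrow> nat pmf" where
  "degree_law m \<alpha> M n =
     bind_pmf (pa_graph m \<alpha> M n) (\<lambda>G.
     bind_pmf (pmf_of_set {1..n}) (\<lambda>v.
     return_pmf (deg G v)))"

text \<open>
  The law of \<open>D'\<close>: the receiver is chosen with multiplicity, i.e. as \<open>w\<^sub>i\<close> with \<open>i\<close> uniform on
  \<open>{1..m}\<close>. For an initial vertex \<open>v\<close>, \<open>D'\<close> is assigned the arbitrary value \<open>d\<^sub>0 v\<close>.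
\<close>

definition receiver_degree_law ::
  "nat \<Rightarrow> real \<Rightarrow> pa_model \<Rightarrow> (nat \<Rightarrow> nat) \<Rightarrow> nat \<Rightarrow> nat pmf" where
  "receiver_degree_law m \<alpha> M d\<^sub>0 n =
     bind_pmf (pa_graph m \<alpha> M n) (\<lambda>G.
     bind_pmf (pmf_of_set {1..n}) (\<lambda>v.
       if v \<le> n_initial m M then return_pmf (d\<^sub>0 v)
       else map_pmf (deg G) (pmf_of_multiset (receivers G v))))"

definition converges_in_distribution :: "(nat \<Rightarrow> nat pmf) \<Rightarrow> nat pmf \<Rightarrow> bool" where
  "converges_in_distribution X L \<longleftrightarrow>
     weak_conv_m (\<lambda>n. distr (measure_pmf (X n)) borel real) (distr (measure_pmf L) borel real)"

end

theory Submission imports Defs "HOL-Real_Asymp.Real_Asymp" begin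

text \<open>
  Both laws are averages over all vertices of a random graph, so they depend only on the expected
  number \<open>N\<^sub>j(n)\<close> of vertices of degree \<open>j\<close>; no concentration result is needed.

  In all three models a vertex of degree \<open>d\<close> receives one edge from the next vertex with probability
  about \<open>c\<^sub>d / n\<close>, where \<open>c\<^sub>d = m \<alpha> + (1 - \<alpha>) d / 2\<close> (\<open>attach_rate\<close>), and several edges with
  negligible probability. Taking expectations,
  \<open>N\<^sub>j(n + 1) = (1 - c\<^sub>j / n) N\<^sub>j(n) + (c\<^sub>j\<^sub>-\<^sub>1 / n) N\<^sub>j\<^sub>-\<^sub>1(n) + [j = m] + o(1)\<close>. A recursion of this
  form forces \<open>N\<^sub>j(n) / n\<close> to converge to the solution of
  \<open>(1 + c\<^sub>j) p\<^sub>j = c\<^sub>j\<^sub>-\<^sub>1 p\<^sub>j\<^sub>-\<^sub>1 + [j = m]\<close> (\<open>averaged_recursion_tendsto\<close>,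
  \<open>expected_degree_count_limit\<close>), and this solution is the stated quotient of Gamma functions
  (\<open>degree_limit_recursion\<close>).

  The law of \<open>D'\<close> follows by double counting. A random edge of a random vertex is a random edge of
  the graph, and a later vertex of degree \<open>j\<close> has received \<open>j - m\<close> edges; hence \<open>P(D' = j)\<close> tends to
  \<open>(j - m) p\<^sub>j / m\<close> (\<open>pmf_receiver_degree_tendsto\<close>).

  The local estimate is immediate for independent choices (\<open>rate_indep\<close>) and an induction over the \<open>m\<close>
  edges for sequential ones (\<open>rate_seq\<close>). In the conditional model, conditioning on distinctness changes
  the probabilities by a factor close to one only if no vertex attracts a positive proportion of
  the edges. As a vertex has degree at most \<open>n + O(1)\<close>, the most likely receiver has probability at
  most \<open>1 / (2 m) + o(1)\<close>, and this crude bound already shows that the expected sum of the squared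
  degrees grows more slowly than \<open>n\<^sup>2\<close> (\<open>expected_sum_squares_tendsto_0\<close>). So the largest degree is
  \<open>o(n)\<close> in mean, which is the missing input (\<open>rate_cond\<close>).

  That the limits are probability distributions is seen by telescoping (\<open>Gamma_quotient_sums\<close>), and
  their power-law tails follow from \<open>Gamma_quotient_asymptotics\<close>.
\<close>

section \<open>A linear recursion\<close>

text \<open>
  The factors \<open>1 - \<kappa> / (n + 1)\<close> have product of order \<open>n powr (- \<kappa>)\<close>, so the initial value is
  forgotten. The perturbation is harmless because \<open>\<delta>\<close> is (almost) a fixed point of the recursion
  with \<open>b n = \<kappa> * \<delta>\<close>: what exceeds \<open>\<delta> / 2\<close> contracts as soon as \<open>b n \<le> \<kappa> * \<delta> / 2\<close>.
\<close>

lemma contracting_recursion_tendsto_0: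
  fixes y b :: "nat \<Rightarrow> real"
  assumes \<kappa>: "\<kappa> > 0" and y: "\<And>n. y n \<ge> 0" and b: "b \<longlonglongrightarrow> 0"
    and step: "\<forall>\<^sub>F n in sequentially. y (Suc n) \<le> (1 - \<kappa> / (real n + 1)) * y n + b n / (real n + 1)"
  shows "y \<longlonglongrightarrow> 0"
proof (rule LIMSEQ_I)
  fix \<delta> :: real assume \<delta>: "\<delta> > 0"
  define z where "z n = max (y n - \<delta> / 2) 0" for n
  have "\<forall>\<^sub>F n in sequentially. b n < \<kappa> * (\<delta> / 2)"
    using b \<kappa> \<delta> by (intro order_tendstoD(2)[of b 0]) auto
  moreover have "\<forall>\<^sub>F n in sequentially. \<kappa> < real n + 1"
    by real_asymp
  ultimately have "\<forall>\<^sub>F n in sequentially. z (Suc n) \<le> (1 - \<kappa> / (real n + 1)) * z n \<and> \<kappa> < real n + 1"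
    using step
  proof eventually_elim
    case (elim n)
    have f: "0 \<le> 1 - \<kappa> / (real n + 1)" using elim by (simp add: field_simps)
    have "y (Suc n) - \<delta> / 2 \<le> (1 - \<kappa> / (real n + 1)) * (y n - \<delta> / 2) + (b n - \<kappa> * (\<delta> / 2)) / (real n + 1)"
      using elim(3) by (simp add: algebra_simps diff_divide_distrib add_divide_distrib)
    also have "\<dots> \<le> (1 - \<kappa> / (real n + 1)) * (y n - \<delta> / 2)"
      using elim(1) by (simp add: divide_le_0_iff)
    also have "\<dots> \<le> (1 - \<kappa> / (real n + 1)) * z n"
      using f by (intro mult_left_mono) (auto simp: z_def)
    finally have "y (Suc n) - \<delta> / 2 \<le> (1 - \<kappa> / (real n + 1)) * z n" .
    moreover have "0 \<le> (1 - \<kappa> / (real n + 1)) * z n" using f by (auto simp: z_def)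
    ultimately show ?case using elim by (simp add: z_def)
  qed
  then obtain N where N: "\<And>n. n \<ge> N \<Longrightarrow> z (Suc n) \<le> (1 - \<kappa> / (real n + 1)) * z n"
    unfolding eventually_sequentially by blast
  \<comment> \<open>Bernoulli fails for \<open>\<kappa> < 1\<close>; bounding by the exponential makes \<open>w\<close> decrease for every \<open>\<kappa>\<close>.\<close>
  define w where "w n = z n * (real n + 1) powr \<kappa>" for n
  have z0: "z n \<ge> 0" for n by (simp add: z_def)
  have w: "w (Suc n) \<le> w n" if "n \<ge> N" for n
  proof -
    have "1 - \<kappa> / (real n + 1) \<le> exp (- \<kappa> / (real n + 1))"
      using exp_ge_add_one_self[of "- \<kappa> / (real n + 1)"] by simp
    also have "\<dots> \<le> exp (- \<kappa> * ln (1 + 1 / (real n + 1)))"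
    proof -
      have "\<kappa> * ln (1 + 1 / (real n + 1)) \<le> \<kappa> * (1 / (real n + 1))"
        using \<kappa> by (intro mult_left_mono ln_add_one_self_le_self) auto
      then show ?thesis by simp
    qed
    also have "\<dots> = (1 + 1 / (real n + 1)) powr (- \<kappa>)"
      by (auto simp: powr_def add_nonneg_eq_0_iff)
    also have "1 + 1 / (real n + 1) = (real n + 2) / (real n + 1)"
      by (simp add: field_simps)
    also have "((real n + 2) / (real n + 1)) powr (- \<kappa>) = (real n + 1) powr \<kappa> / (real n + 2) powr \<kappa>"
      by (simp add: powr_divide powr_minus field_simps)
    finally have *: "1 - \<kappa> / (real n + 1) \<le> (real n + 1) powr \<kappa> / (real n + 2) powr \<kappa>" .
    have "z (Suc n) \<le> z n * ((real n + 1) powr \<kappa> / (real n + 2) powr \<kappa>)"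
      using N[OF that] mult_right_mono[OF * z0[of n]] by (simp add: mult.commute)
    then have "z (Suc n) * (real n + 2) powr \<kappa> \<le> z n * ((real n + 1) powr \<kappa> / (real n + 2) powr \<kappa>) * (real n + 2) powr \<kappa>"
      by (intro mult_right_mono) auto
    then show ?thesis by (simp add: w_def add.commute)
  qed
  have wN: "w n \<le> w N" if "n \<ge> N" for n
    using that
  proof (induction rule: dec_induct)
    case (step n)
    then show ?case using w[of n] by linarith
  qed simp
  have "(\<lambda>n. w N * (real n + 1) powr (- \<kappa>)) \<longlonglongrightarrow> 0"
    using \<kappa> by real_asymp
  then have "\<forall>\<^sub>F n in sequentially. w N * (real n + 1) powr (- \<kappa>) < \<delta> / 2"
    using \<delta> by (intro order_tendstoD(2)) auto
  then have "\<forall>\<^sub>F n in sequentially. y n < \<delta>"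
    using eventually_ge_at_top[of N]
  proof eventually_elim
    case (elim n)
    have "z n = w n * (real n + 1) powr (- \<kappa>)" by (simp add: w_def powr_minus)
    also have "\<dots> \<le> w N * (real n + 1) powr (- \<kappa>)" using wN[OF elim(2)] by (intro mult_right_mono) auto
    finally show ?case using elim by (simp add: z_def)
  qed
  then show "\<exists>no. \<forall>n\<ge>no. norm (y n - 0) < \<delta>"
    using y by (auto simp: eventually_sequentially)
qed

text \<open>
  If the averages \<open>N n / n\<close> settle at a value \<open>p\<close>, the increments \<open>b - c * p\<close> must equal \<open>p\<close>;
  this is where \<open>b = (1 + c) * p\<close> comes from. The distance of the average from \<open>p\<close> obeys the
  contracting recursion with \<open>\<kappa> = 1 + c\<close>.
\<close>

lemma averaged_recursion_tendsto:
  fixes N b e :: "nat \<Rightarrow> real"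
  assumes c: "c \<ge> 0" and b: "b \<longlonglongrightarrow> (1 + c) * p" and e: "e \<longlonglongrightarrow> 0"
    and step: "\<forall>\<^sub>F n in sequentially. \<bar>N (Suc n) - ((1 - c / real n) * N n + b n)\<bar> \<le> e n"
  shows "(\<lambda>n. N n / real n) \<longlonglongrightarrow> p"
proof -
  have "(\<lambda>n. \<bar>N n / real n - p\<bar>) \<longlonglongrightarrow> 0"
  proof (rule contracting_recursion_tendsto_0[where \<kappa> = "1 + c" and b = "\<lambda>n. \<bar>b n - (1 + c) * p\<bar> + e n"])
    show "(\<lambda>n. \<bar>b n - (1 + c) * p\<bar> + e n) \<longlonglongrightarrow> 0"
      using tendsto_add[OF tendsto_rabs_zero[OF LIM_zero[OF b]] e] by simp
    show "\<forall>\<^sub>F n in sequentially. \<bar>N (Suc n) / real (Suc n) - p\<bar>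
        \<le> (1 - (1 + c) / (real n + 1)) * \<bar>N n / real n - p\<bar> + (\<bar>b n - (1 + c) * p\<bar> + e n) / (real n + 1)"
      using step eventually_gt_at_top[of 0] eventually_ge_at_top[of "nat \<lceil>c\<rceil>"]
    proof eventually_elim
      case (elim n)
      then have n: "real n > 0" "c \<le> real n" by (auto simp: nat_le_iff ceiling_le_iff)
      define r where "r = N (Suc n) - ((1 - c / real n) * N n + b n)"
      have "N (Suc n) / (real n + 1) - p
          = ((1 - c / real n) * N n + b n + r) / (real n + 1) - p" by (simp add: r_def)
      also have "\<dots> = (1 - (1 + c) / (real n + 1)) * (N n / real n - p) + ((b n - (1 + c) * p) + r) / (real n + 1)"
      proof -
        define q where "q = N n / real n"
        have q: "(1 - c / real n) * N n = (real n - c) * q"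
          using n by (simp add: q_def field_simps)
        have 1: "1 - (1 + c) / (real n + 1) = (real n - c) / (real n + 1)"
          by (simp add: field_simps)
        have 2: "p = p * (real n + 1) / (real n + 1)"
          using n by simp
        have "((real n - c) * q + b n + r) / (real n + 1) - p
            = ((real n - c) * q + b n + r - p * (real n + 1)) / (real n + 1)"
          by (subst 2) (simp only: diff_divide_distrib)
        also have "(real n - c) * q + b n + r - p * (real n + 1)
            = (real n - c) * (q - p) + ((b n - (1 + c) * p) + r)"
          by (simp add: algebra_simps)
        finally show ?thesis
          unfolding q 1 q_def[symmetric] by (simp add: add_divide_distrib)
      qed
      also have "\<bar>\<dots>\<bar> \<le> \<bar>(1 - (1 + c) / (real n + 1)) * (N n / real n - p)\<bar> + \<bar>((b n - (1 + c) * p) + r) / (real n + 1)\<bar>"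
        by (rule abs_triangle_ineq)
      also have "\<bar>(1 - (1 + c) / (real n + 1)) * (N n / real n - p)\<bar> = (1 - (1 + c) / (real n + 1)) * \<bar>N n / real n - p\<bar>"
      proof -
        have "0 \<le> 1 - (1 + c) / (real n + 1)" using n by (simp add: field_simps)
        then show ?thesis by (simp add: abs_mult)
      qed
      also have "\<bar>((b n - (1 + c) * p) + r) / (real n + 1)\<bar> \<le> (\<bar>b n - (1 + c) * p\<bar> + e n) / (real n + 1)"
        using elim(1) unfolding abs_divide r_def by (intro frac_le) auto
      finally show ?case by (simp add: add.commute)
    qed
  qed (use c in auto)
  then show ?thesis
    by (metis tendsto_rabs_zero_iff LIM_zero_iff)
qed

section \<open>Quotients of Gamma functions\<close>

text \<open>
  Increments of order \<open>1 / k\<^sup>2\<close> are dominated by those of \<open>2 * C / k\<close>, so \<open>f k - 2 * C / k\<close>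
  increases, \<open>f k + 2 * C / k\<close> decreases, and the limit is caught between them.
\<close>

lemma abs_diff_summable_rate:
  fixes f :: "nat \<Rightarrow> real"
  assumes C: "C \<ge> 0" and step: "\<And>k. k \<ge> K \<Longrightarrow> \<bar>f (Suc k) - f k\<bar> \<le> C / real k ^ 2" and K: "K \<ge> 1"
  obtains L where "\<And>k. k \<ge> K \<Longrightarrow> \<bar>f k - L\<bar> \<le> 2 * C / real k"
proof -
  define lo where "lo k = f k - 2 * C / real k" for k
  define hi where "hi k = f k + 2 * C / real k" for k
  have gap: "C / real k ^ 2 \<le> 2 * C / real k - 2 * C / real (Suc k)" if "k \<ge> K" for k
  proof -
    have k: "real k \<ge> 1" using that K by simp
    have "2 * C / real k - 2 * C / real (Suc k) = 2 * C / (real k * (real k + 1))"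
      using k by (simp add: field_simps)
    moreover have "C / real k ^ 2 = 2 * C / (2 * real k ^ 2)" by simp
    moreover have "2 * C / (2 * real k ^ 2) \<le> 2 * C / (real k * (real k + 1))"
      using k C by (intro divide_left_mono mult_pos_pos) (auto simp: power2_eq_square)
    ultimately show ?thesis by simp
  qed
  have lo: "lo k \<le> lo (Suc k)" and hi: "hi (Suc k) \<le> hi k" if "k \<ge> K" for k
    using step[OF that] gap[OF that] by (auto simp: lo_def hi_def)
  have lo_mono: "lo k \<le> lo l" and hi_mono: "hi l \<le> hi k" if "K \<le> k" "k \<le> l" for k l
  proof -
    show "lo k \<le> lo l"
      using that(2)
    proof (induction rule: dec_induct)
      case (step l)
      then show ?case using lo[of l] that(1) by linarith
    qed simp
    show "hi l \<le> hi k"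
      using that(2)
    proof (induction rule: dec_induct)
      case (step l)
      then show ?case using hi[of l] that(1) by linarith
    qed simp
  qed
  have lohi: "lo k \<le> hi l" if "K \<le> k" "K \<le> l" for k l
  proof -
    have "lo k \<le> lo (max k l)" using lo_mono that by simp
    also have "\<dots> \<le> hi (max k l)" using C by (simp add: lo_def hi_def)
    also have "\<dots> \<le> hi l" using hi_mono that by simp
    finally show ?thesis .
  qed
  define L where "L = (SUP k\<in>{K..}. lo k)"
  have "lo k \<le> L" if "k \<ge> K" for k
    unfolding L_def using that lohi[of _ K] by (intro cSUP_upper) (auto intro!: bdd_aboveI2[where M = "hi K"])
  moreover have "L \<le> hi k" if "k \<ge> K" for k
    unfolding L_def using that lohi by (intro cSUP_least) auto
  ultimately have "\<bar>f k - L\<bar> \<le> 2 * C / real k" if "k \<ge> K" for k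
    unfolding lo_def hi_def abs_le_iff using that by (simp add: algebra_simps) 
  then show ?thesis by (rule that)
qed

text \<open>
  The logarithm of the quotient, normalised by \<open>k powr (y - x)\<close>, has increments of order
  \<open>1 / k\<^sup>2\<close> by the functional equation of \<open>Gamma\<close>; hence it converges with error \<open>O(1 / k)\<close>. The
  value of the limit is not determined, only that its exponential \<open>C\<close> is positive.
\<close>

lemma Gamma_quotient_asymptotics:
  fixes x y :: real
  assumes x: "x > 0" and y: "y > 0"
  shows "\<exists>C r. C > 0 \<and> r \<in> O(\<lambda>k. 1 / real k) \<and>
    (\<forall>k\<ge>1. Gamma (real k + x) / Gamma (real k + y) = C * real k powr (x - y) * (1 + r k))"
proof -
  define g where "g k = Gamma (real k + x) / Gamma (real k + y) * real k powr (y - x)" for k :: nat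
  define f where "f k = ln (g k)" for k
  have gpos: "g k > 0" if "k \<ge> 1" for k
    using x y that by (auto simp: g_def intro!: mult_pos_pos divide_pos_pos Gamma_real_pos)
  have step: "f (Suc k) - f k = ln ((real k + x) / (real k + y)) + (y - x) * ln (1 + 1 / real k)" if "k \<ge> 1" for k
  proof -
    have G: "Gamma (real (Suc k) + t) = (real k + t) * Gamma (real k + t)" if "t > 0" for t :: real
      using Gamma_plus1[of "real k + t"] that \<open>k \<ge> 1\<close> by (simp add: add_ac nonpos_Ints_def)
    have g_Suc: "g (Suc k) = g k * ((real k + x) / (real k + y)) * (1 + 1 / real k) powr (y - x)"
    proof -
      have "real (Suc k) powr (y - x) = real k powr (y - x) * (1 + 1 / real k) powr (y - x)"
        using that by (subst powr_mult[symmetric]) (auto simp: distrib_left add.commute)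
      then show ?thesis unfolding g_def G[OF x] G[OF y] by (simp add: mult_ac)
    qed
    have "ln (G * Q * R powr t) - ln G = ln Q + t * ln R" if "G > 0" "Q > 0" "R > 0" for G Q R t :: real
      using that by (simp add: ln_mult_pos ln_powr)
    moreover have "1 + 1 / real k > 0" by (simp add: add_pos_nonneg)
    moreover have "(real k + x) / (real k + y) > 0" using x y by (intro divide_pos_pos) auto
    ultimately
    have "ln (g k * ((real k + x) / (real k + y)) * (1 + 1 / real k) powr (y - x)) - ln (g k)
        = ln ((real k + x) / (real k + y)) + (y - x) * ln (1 + 1 / real k)"
      using gpos[OF that] by blast
    then show ?thesis by (simp only: f_def g_Suc)
  qed
  have "(\<lambda>k::nat. ln ((real k + x) / (real k + y)) + (y - x) * ln (1 + 1 / real k)) \<in> O(\<lambda>k. 1 / real k ^ 2)"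
    by real_asymp
  then obtain C where C: "C > 0" "\<forall>\<^sub>F k in sequentially.
      \<bar>ln ((real k + x) / (real k + y)) + (y - x) * ln (1 + 1 / real k)\<bar> \<le> C * \<bar>1 / real k ^ 2\<bar>"
    by (auto elim!: landau_o.bigE)
  from C(2) eventually_ge_at_top[of 1] have "\<forall>\<^sub>F k in sequentially. \<bar>f (Suc k) - f k\<bar> \<le> C / real k ^ 2"
    by eventually_elim (simp add: step)
  then obtain K' where K': "\<And>k. k \<ge> K' \<Longrightarrow> \<bar>f (Suc k) - f k\<bar> \<le> C / real k ^ 2"
    unfolding eventually_sequentially by blast
  obtain L where L: "\<And>k. k \<ge> max K' 1 \<Longrightarrow> \<bar>f k - L\<bar> \<le> 2 * C / real k"
    by (rule abs_diff_summable_rate[of C "max K' 1" f]) (use C K' in auto)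
  define r where "r k = exp (f k - L) - 1" for k
  have "r \<in> O(\<lambda>k. 1 / real k)"
  proof (rule bigoI[where c = "4 * C"])
    have "\<forall>\<^sub>F k in sequentially. 2 * C / real k \<le> 1 / 2"
      by real_asymp
    then show "\<forall>\<^sub>F k in sequentially. norm (r k) \<le> 4 * C * norm (1 / real k)"
      using eventually_ge_at_top[of "max K' 1"]
    proof eventually_elim
      case (elim k)
      have "\<bar>f k - L\<bar> \<le> 1 / 2" using order_trans[OF L[OF elim(2)] elim(1)] .
      then have "exp (f k - L) \<le> 1 + 2 * \<bar>f k - L\<bar>"
        using exp_bound_lemma[of "f k - L"] by simp
      moreover have "exp (f k - L) \<ge> 1 + (f k - L)" by (rule exp_ge_add_one_self)
      moreover have "\<bar>x - 1\<bar> \<le> 2 * \<bar>t\<bar>" if "x \<le> 1 + 2 * \<bar>t\<bar>" "1 + t \<le> x" for x t :: real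
        using that by (cases "t \<ge> 0"; cases "x \<ge> 1") auto
      ultimately have "\<bar>r k\<bar> \<le> 2 * \<bar>f k - L\<bar>"
        unfolding r_def by blast
      then show ?case using L[of k] elim by simp
    qed
  qed
  moreover have "Gamma (real k + x) / Gamma (real k + y) = exp L * real k powr (x - y) * (1 + r k)" if "k \<ge> 1" for k
  proof -
    have "exp L * (1 + r k) = g k"
      using gpos[OF that] by (simp add: r_def f_def exp_diff)
    then have "exp L * real k powr (x - y) * (1 + r k) = g k * real k powr (x - y)" by (simp add: mult_ac)
    also have "\<dots> = Gamma (real k + x) / Gamma (real k + y)"
      using that by (simp add: g_def powr_add[symmetric])
    finally show ?thesis ..
  qed
  ultimately show ?thesis by (intro exI[of _ "exp L"] exI[of _ r]) auto
qed

text \<open>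
  The terms are, up to the factor \<open>c\<close>, the differences of the null sequence
  \<open>Gamma (k + x) / Gamma (k + x + c)\<close>.
\<close>

lemma Gamma_quotient_sums:
  fixes x c :: real
  assumes x: "x > 0" and c: "c > 0"
  shows "(\<lambda>k. Gamma (real k + x) / Gamma (real k + x + c + 1)) sums (Gamma x / (c * Gamma (x + c)))"
proof -
  define T where "T k = Gamma (real k + x) / Gamma (real k + x + c)" for k :: nat
  have "T k - T (Suc k) = c * (Gamma (real k + x) / Gamma (real k + x + c + 1))" for k
  proof -
    have p: "real k + x > 0" "real k + x + c > 0" using x c by auto
    have 1: "Gamma (real (Suc k) + x) = (real k + x) * Gamma (real k + x)"
      using Gamma_plus1[of "real k + x"] p by (simp add: add_ac nonpos_Ints_def)
    have 2: "Gamma (real k + x + c + 1) = (real k + x + c) * Gamma (real k + x + c)"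
      using p by (intro Gamma_plus1) (simp add: nonpos_Ints_def)
    have 3: "real (Suc k) + x + c = real k + x + c + 1" by simp
    have G: "Gamma (real k + x + c) > 0" using p by (intro Gamma_real_pos)
    have "u / v - p * u / (q * v) = (q - p) * (u / (q * v))" if "v > 0" "q > 0" for u v p q :: real
      using that by (simp add: field_simps)
    from this[OF G p(2)] show ?thesis unfolding T_def 1 3 2 by simp
  qed
  moreover have "T \<longlonglongrightarrow> 0"
  proof -
    obtain C r where r: "r \<in> O(\<lambda>k. 1 / real k)"
      and eq: "\<And>k. k \<ge> 1 \<Longrightarrow> Gamma (real k + x) / Gamma (real k + (x + c)) = C * real k powr (x - (x + c)) * (1 + r k)"
      using Gamma_quotient_asymptotics[of x "x + c"] x c by auto
    have "r \<longlonglongrightarrow> 0"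
      by (rule landau_o.big_small_trans [OF r, THEN smalloD_tendsto, of "\<lambda>_. 1", simplified]) real_asymp
    moreover have "(\<lambda>k. real k powr (- c)) \<longlonglongrightarrow> 0" using c by real_asymp
    ultimately have "(\<lambda>k. C * real k powr (- c) * (1 + r k)) \<longlonglongrightarrow> C * 0 * (1 + 0)"
      by (intro tendsto_intros)
    moreover have "\<forall>\<^sub>F k in sequentially. C * real k powr (- c) * (1 + r k) = T k"
      using eventually_ge_at_top[of 1] by eventually_elim (use eq in \<open>simp add: T_def add.assoc\<close>)
    ultimately show ?thesis by (simp add: tendsto_cong)
  qed
  ultimately have "(\<lambda>k. c * (Gamma (real k + x) / Gamma (real k + x + c + 1))) sums (T 0 - 0)"
    using telescope_sums'[of T 0] by simp
  then have "(\<lambda>k. c * (Gamma (real k + x) / Gamma (real k + x + c + 1)) / c) sums (T 0 / c)"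
    by (intro sums_divide) simp
  then show ?thesis using c by (simp add: T_def field_simps)
qed

section \<open>Expectations under finitely supported laws\<close>

abbreviation expect :: "'a pmf \<Rightarrow> ('a \<Rightarrow> real) \<Rightarrow> real" where
  "expect p f \<equiv> measure_pmf.expectation p f"

lemma expect_add:
  "finite (set_pmf p) \<Longrightarrow> expect p (\<lambda>x. f x + g x) = expect p f + expect p g"
  by (intro Bochner_Integration.integral_add integrable_measure_pmf_finite)

lemma expect_diff:
  "finite (set_pmf p) \<Longrightarrow> expect p (\<lambda>x. f x - g x) = expect p f - expect p g"
  by (intro Bochner_Integration.integral_diff integrable_measure_pmf_finite)

lemma expect_sum:
  "finite (set_pmf p) \<Longrightarrow> expect p (\<lambda>x. \<Sum>i\<in>I. f i x) = (\<Sum>i\<in>I. expect p (f i))"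
  by (intro Bochner_Integration.integral_sum integrable_measure_pmf_finite)

lemma expect_mono:
  "finite (set_pmf p) \<Longrightarrow> (\<And>x. x \<in> set_pmf p \<Longrightarrow> f x \<le> g x) \<Longrightarrow> expect p f \<le> expect p g"
  by (intro integral_mono_AE integrable_measure_pmf_finite) (auto simp: AE_measure_pmf_iff)

lemma expect_cong:
  "(\<And>x. x \<in> set_pmf p \<Longrightarrow> f x = g x) \<Longrightarrow> expect p f = expect p g"
  by (intro integral_cong_AE) (auto simp: AE_measure_pmf_iff)

lemma expect_nonneg:
  "(\<And>x. x \<in> set_pmf p \<Longrightarrow> 0 \<le> f x) \<Longrightarrow> 0 \<le> expect p f"
  by (intro integral_nonneg_AE) (auto simp: AE_measure_pmf_iff)

lemma expect_le_const:
  "finite (set_pmf p) \<Longrightarrow> (\<And>x. x \<in> set_pmf p \<Longrightarrow> f x \<le> c) \<Longrightarrow> expect p f \<le> c"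
  using expect_mono[of p f "\<lambda>_. c"] by simp

lemma expect_abs_diff_le:
  assumes "finite (set_pmf p)" and "\<And>x. x \<in> set_pmf p \<Longrightarrow> \<bar>f x - g x\<bar> \<le> h x"
  shows "\<bar>expect p f - expect p g\<bar> \<le> expect p h"
proof -
  have "\<bar>expect p (\<lambda>x. f x - g x)\<bar> \<le> expect p (\<lambda>x. \<bar>f x - g x\<bar>)"
    by (rule integral_abs_bound)
  also have "\<dots> \<le> expect p h" using assms by (intro expect_mono)
  finally show ?thesis using assms(1) by (simp add: expect_diff)
qed

lemma expect_bind:
  assumes "finite (set_pmf p)" and "\<And>x. x \<in> set_pmf p \<Longrightarrow> finite (set_pmf (f x))"
  shows "expect (bind_pmf p f) h = expect p (\<lambda>x. expect (f x) h)"
  using assms by (subst pmf_expectation_bind[of "set_pmf p"], auto)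
    (subst integral_measure_pmf[of "set_pmf p"], auto)

section \<open>Degrees after the arrival of a vertex\<close>

definition attach :: "mgraph \<Rightarrow> nat \<Rightarrow> nat list \<Rightarrow> mgraph" where
  "attach G v ws = G + image_mset (Pair v) (mset ws)"

lemma endpoints_attach:
  "endpoints (attach G v ws) = endpoints G + replicate_mset (length ws) v + mset ws"
  by (simp add: endpoints_def attach_def multiset.map_comp comp_def image_mset_const_eq)

lemma deg_attach:
  "deg (attach G v ws) k = deg G k + count (mset ws) k + (if k = v then length ws else 0)"
  by (simp add: deg_def endpoints_attach)

lemma receivers_attach:
  "receivers (attach G v ws) u = receivers G u + (if u = v then mset ws else {#})"
  by (auto simp: receivers_def attach_def filter_mset_image_mset multiset.map_comp comp_def)

lemma deg_eq_0: "set_mset G \<subseteq> {1..n} \<times> {1..n} \<Longrightarrow> k \<notin> {1..n} \<Longrightarrow> deg G k = 0"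
  by (auto simp: deg_def endpoints_def count_eq_zero_iff simp flip: not_in_iff)

definition degree_count :: "nat \<Rightarrow> nat \<Rightarrow> mgraph \<Rightarrow> real" where
  "degree_count n j G = (\<Sum>k\<in>{1..n}. of_bool (deg G k = j))"

lemma degree_count_attach:
  assumes "set_mset G \<subseteq> {1..n} \<times> {1..n}" and "length ws = m" and "set ws \<subseteq> {1..n}"
  shows "degree_count (Suc n) j (attach G (Suc n) ws)
    = (\<Sum>k\<in>{1..n}. of_bool (deg G k + count (mset ws) k = j)) + of_bool (j = m)"
proof -
  have "deg G (Suc n) = 0" using assms(1) by (intro deg_eq_0) auto
  moreover have "count (mset ws) (Suc n) = 0" using assms(3) by (auto simp: count_eq_zero_iff)
  moreover have "{1..Suc n} = insert (Suc n) {1..n}" by auto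
  moreover have "(\<Sum>k\<in>{1..n}. of_bool (deg (attach G (Suc n) ws) k = j) :: real)
      = (\<Sum>k\<in>{1..n}. of_bool (deg G k + count (mset ws) k = j))"
    by (intro sum.cong) (auto simp: deg_attach)
  ultimately show ?thesis
    using assms(2) by (auto simp: degree_count_def deg_attach simp del: sum_of_bool_eq)
qed

text \<open>
  To first order in the increment \<open>x\<close>, a vertex of degree \<open>d\<close> has degree \<open>j\<close> afterwards if
  \<open>d = j\<close> and it gains nothing, or \<open>d + 1 = j\<close> and it gains one edge. The linear expression agrees
  with the indicator for \<open>x \<le> 1\<close>; the factorial moment \<open>x * (x - 1)\<close> pays for multiple edges, and
  only vertices with \<open>d \<le> j\<close> can contribute.
\<close>

lemma of_bool_deg_increment:
  fixes d x j :: nat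
  shows "\<bar>of_bool (d + x = j) - ((1 - real x) * of_bool (d = j) + real x * of_bool (Suc d = j))\<bar>
    \<le> real x * (real x - 1) * of_bool (d \<le> j)"
proof -
  consider "x = 0" | "x = 1" | "x \<ge> 2" by linarith
  then show ?thesis
  proof cases
    case 3
    have "real x * 1 \<le> real x * (real x - 1)" using 3 by (intro mult_left_mono) auto
    then show ?thesis using 3 by (auto simp: of_bool_def intro: order_trans[of 1 "real x"])
  qed auto
qed

text \<open>
  Summing the first-order expansion over all vertices. Precise attachment probabilities are required
  only for vertices of degree at most \<open>j\<close>, so that the vertices of large degree do not matter.
\<close>

lemma expected_degree_count_attach:
  fixes \<epsilon> :: real and c :: "nat \<Rightarrow> real"
  assumes n: "n > 0" and G: "set_mset G \<subseteq> {1..n} \<times> {1..n}"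
    and fin: "finite (set_pmf W)"
    and W: "\<And>ws. ws \<in> set_pmf W \<Longrightarrow> length ws = m \<and> set ws \<subseteq> {1..n}"
    and \<epsilon>: "\<epsilon> \<ge> 0"
    and mean: "\<And>k. k \<in> {1..n} \<Longrightarrow> deg G k \<le> j \<Longrightarrow>
        \<bar>expect W (\<lambda>ws. count (mset ws) k) - c (deg G k) / n\<bar> \<le> \<epsilon> / n"
    and multi: "\<And>k. k \<in> {1..n} \<Longrightarrow> deg G k \<le> j \<Longrightarrow>
        expect W (\<lambda>ws. real (count (mset ws) k) * (real (count (mset ws) k) - 1)) \<le> \<epsilon> / n"
  shows "\<bar>expect W (\<lambda>ws. degree_count (Suc n) j (attach G (Suc n) ws))
     - ((1 - c j / n) * degree_count n j G
        + (of_bool (j = m) + (if j = 0 then 0 else c (j - 1) / n * degree_count n (j - 1) G)))\<bar> \<le> 2 * \<epsilon>"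
proof -
  let ?X = "\<lambda>k ws. real (count (mset ws) k)"
  define g where "g k = (1 - c j / n) * of_bool (deg G k = j) + c (deg G k) / n * of_bool (Suc (deg G k) = j)" for k
  have one: "\<bar>expect W (\<lambda>ws. of_bool (deg G k + count (mset ws) k = j)) - g k\<bar> \<le> 2 * \<epsilon> / n"
    if k: "k \<in> {1..n}" for k
  proof (cases "deg G k \<le> j")
    case True
    let ?d = "deg G k"
    have "\<bar>expect W (\<lambda>ws. of_bool (?d + count (mset ws) k = j))
        - expect W (\<lambda>ws. (1 - ?X k ws) * of_bool (?d = j) + ?X k ws * of_bool (Suc ?d = j))\<bar>
        \<le> expect W (\<lambda>ws. ?X k ws * (?X k ws - 1) * of_bool (?d \<le> j))"
      by (intro expect_abs_diff_le fin of_bool_deg_increment)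
    also have "\<dots> \<le> \<epsilon> / n" using multi[OF k True] True by simp
    also have "expect W (\<lambda>ws. (1 - ?X k ws) * of_bool (?d = j) + ?X k ws * of_bool (Suc ?d = j))
        = (1 - expect W (?X k)) * of_bool (?d = j) + expect W (?X k) * of_bool (Suc ?d = j)"
      by (simp add: expect_add expect_diff fin)
    finally show ?thesis
      using mean[OF k True] by (auto simp: g_def split: if_splits)
  next
    case False
    then show ?thesis using \<epsilon> by (auto simp: g_def)
  qed
  have "expect W (\<lambda>ws. degree_count (Suc n) j (attach G (Suc n) ws))
      = expect W (\<lambda>ws. (\<Sum>k\<in>{1..n}. of_bool (deg G k + count (mset ws) k = j)) + of_bool (j = m))"
    using W by (intro expect_cong degree_count_attach G) auto
  also have "\<dots> = (\<Sum>k\<in>{1..n}. expect W (\<lambda>ws. of_bool (deg G k + count (mset ws) k = j))) + of_bool (j = m)"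
    by (simp add: expect_add expect_sum fin del: sum_of_bool_eq)
  finally have E: "expect W (\<lambda>ws. degree_count (Suc n) j (attach G (Suc n) ws)) = \<dots>" .
  have "(\<Sum>k\<in>{1..n}. c (deg G k) / n * of_bool (Suc (deg G k) = j))
      = (if j = 0 then 0 else c (j - 1) / n * degree_count n (j - 1) G)"
    unfolding degree_count_def sum_distrib_left
    by (cases j) (auto intro!: sum.cong)
  then have g: "(\<Sum>k\<in>{1..n}. g k) = (1 - c j / n) * degree_count n j G
      + (if j = 0 then 0 else c (j - 1) / n * degree_count n (j - 1) G)"
    by (simp only: g_def sum.distrib degree_count_def sum_distrib_left)
  have "\<bar>(\<Sum>k\<in>{1..n}. expect W (\<lambda>ws. of_bool (deg G k + count (mset ws) k = j))) - (\<Sum>k\<in>{1..n}. g k)\<bar>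
      \<le> (\<Sum>k\<in>{1..n}. 2 * \<epsilon> / n)"
    unfolding sum_subtractf[symmetric] by (intro order_trans[OF sum_abs] sum_mono one)
  also have "\<dots> = 2 * \<epsilon>" using n by simp
  finally show ?thesis unfolding E g by (simp add: algebra_simps)
qed

section \<open>The growth process\<close>

text \<open>
  What every reachable graph satisfies. The last two clauses say that the edges of \<open>G\<close> are those of
  \<open>H\<close> together with exactly \<open>m\<close> edges sent out by each later vertex.
\<close>

definition grown :: "nat \<Rightarrow> nat \<Rightarrow> mgraph \<Rightarrow> nat \<Rightarrow> mgraph \<Rightarrow> bool" where
  "grown m s H n G \<longleftrightarrow> set_mset G \<subseteq> {1..n} \<times> {1..n} \<and> size G = size H + m * (n - s)
     \<and> (\<forall>v\<in>{s<..n}. size (receivers G v) = m) \<and> filter_mset (\<lambda>e. fst e \<le> s) G = H"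

lemma grown_initial:
  assumes "set_mset H \<subseteq> {1..s} \<times> {1..s}"
  shows "grown m s H s H"
proof -
  have "filter_mset (\<lambda>e. fst e \<le> s) H = H"
    using assms by (subst filter_mset_eq_conv) force
  then show ?thesis using assms by (simp add: grown_def)
qed

lemma grown_attach:
  assumes G: "grown m s H n G" and n: "n \<ge> s" and ws: "length ws = m" "set ws \<subseteq> {1..n}"
  shows "grown m s H (Suc n) (attach G (Suc n) ws)"
proof -
  have sub: "set_mset G \<subseteq> {1..n} \<times> {1..n}" using G by (simp add: grown_def)
  have "receivers G (Suc n) = {#}" using sub by (force simp: receivers_def filter_mset_eq_mempty_iff)
  moreover have "filter_mset (\<lambda>e. fst e \<le> s) (image_mset (Pair (Suc n)) (mset ws)) = {#}"
    using n by (auto simp: filter_mset_eq_mempty_iff)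
  moreover have "{s<..Suc n} = insert (Suc n) {s<..n}" using n by auto
  ultimately show ?thesis
    using G n ws by (auto simp: grown_def receivers_attach Suc_diff_le) (auto simp: attach_def)
qed

lemma set_grow_invariant:
  assumes init: "P s H"
    and step: "\<And>n G ws. n \<ge> s \<Longrightarrow> P n G \<Longrightarrow> ws \<in> set_pmf (rule (Suc n) G) \<Longrightarrow> P (Suc n) (attach G (Suc n) ws)"
    and n: "n \<ge> s" and G: "G \<in> set_pmf (grow s H rule n)"
  shows "P n G"
  using n G
proof (induction arbitrary: G rule: dec_induct)
  case base
  then show ?case using init by (cases s) auto
next
  case (step n)
  then show ?case using assms(2) by (auto simp: attach_def)
qed

text \<open>
  The support condition is imposed only on graphs that the process can reach: elsewhere a rule may be
  ill-defined (a uniform choice from an empty multiset, conditioning on a null event).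
\<close>

locale attachment_process =
  fixes m s :: nat and H :: mgraph and rule :: "nat \<Rightarrow> mgraph \<Rightarrow> nat list pmf"
  assumes m: "m \<ge> 1" and s: "s \<ge> 1" and H: "set_mset H \<subseteq> {1..s} \<times> {1..s}"
    and rule: "\<And>n G ws. n \<ge> s \<Longrightarrow> G \<in> set_pmf (grow s H rule n) \<Longrightarrow> ws \<in> set_pmf (rule (Suc n) G) \<Longrightarrow>
      length ws = m \<and> set ws \<subseteq> {1..n}"
begin

abbreviation law :: "nat \<Rightarrow> mgraph pmf" where
  "law \<equiv> grow s H rule"

lemma law_Suc: "n \<ge> s \<Longrightarrow> law (Suc n) = bind_pmf (law n) (\<lambda>G. map_pmf (attach G (Suc n)) (rule (Suc n) G))"
  by (simp add: attach_def[abs_def])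

lemma finite_rule:
  assumes "n \<ge> s" "G \<in> set_pmf (law n)"
  shows "finite (set_pmf (rule (Suc n) G))"
  by (rule finite_subset[OF _ finite_lists_length_eq[of "{1..n}" m]]) (use rule[OF assms] in auto)

lemma finite_law: "finite (set_pmf (law n))"
proof (induction n)
  case (Suc n)
  show ?case
  proof (cases "Suc n \<le> s")
    case False
    then have "n \<ge> s" by simp
    with Suc finite_rule[OF this] show ?thesis by (simp add: law_Suc del: grow.simps(2))
  qed simp
qed simp

lemma law_grown:
  assumes "n \<ge> s" "G \<in> set_pmf (law n)"
  shows "grown m s H n G"
  using assms
proof (induction arbitrary: G rule: dec_induct)
  case base
  then show ?case using grown_initial[OF H] by (cases s) auto
next
  case (step k)
  from step.prems step.hyps obtain F ws where F: "F \<in> set_pmf (law k)"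
    and ws: "ws \<in> set_pmf (rule (Suc k) F)" and G: "G = attach F (Suc k) ws"
    by (auto simp: law_Suc simp del: grow.simps(2))
  show ?case unfolding G using rule[OF step.hyps(1) F ws] step.hyps step.IH[OF F]
    by (intro grown_attach) auto
qed

lemma expect_law_Suc:
  assumes "n \<ge> s"
  shows "expect (law (Suc n)) f = expect (law n) (\<lambda>G. expect (rule (Suc n) G) (\<lambda>ws. f (attach G (Suc n) ws)))"
  unfolding law_Suc[OF assms]
  by (subst expect_bind) (auto intro: finite_law finite_rule assms simp: integral_map_pmf)

text \<open>
  The master equation of the degree distribution. The error \<open>\<epsilon>\<close> may depend on the graph and has to
  vanish only in mean; the conditional model makes use of this freedom, since its attachment
  probabilities are close to the unconditioned ones only in graphs without a dominating vertex.
\<close>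

theorem expected_degree_count_limit:
  fixes c p :: "nat \<Rightarrow> real"
  assumes c: "\<And>j. c j \<ge> 0"
    and p: "\<And>j. (1 + c j) * p j = of_bool (j = m) + (if j = 0 then 0 else c (j - 1) * p (j - 1))"
    and local: "\<And>j. \<exists>\<epsilon>. (\<forall>n G. 0 \<le> \<epsilon> n G) \<and> (\<lambda>n. expect (law n) (\<epsilon> n)) \<longlonglongrightarrow> 0 \<and>
      (\<forall>\<^sub>F n in sequentially. \<forall>G\<in>set_pmf (law n). \<forall>k\<in>{1..n}. deg G k \<le> j \<longrightarrow>
        \<bar>expect (rule (Suc n) G) (\<lambda>ws. count (mset ws) k) - c (deg G k) / n\<bar> \<le> \<epsilon> n G / n \<and>
        expect (rule (Suc n) G) (\<lambda>ws. real (count (mset ws) k) * (real (count (mset ws) k) - 1)) \<le> \<epsilon> n G / n)"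
  shows "(\<lambda>n. expect (law n) (degree_count n j) / n) \<longlonglongrightarrow> p j"
proof (induction j rule: less_induct)
  case (less j)
  define N where "N i n = expect (law n) (degree_count n i)" for i n
  obtain \<epsilon> :: "nat \<Rightarrow> mgraph \<Rightarrow> real" where \<epsilon>0: "\<And>n G. 0 \<le> \<epsilon> n G" and \<epsilon>: "(\<lambda>n. expect (law n) (\<epsilon> n)) \<longlonglongrightarrow> 0"
    and ev: "\<forall>\<^sub>F n in sequentially. \<forall>G\<in>set_pmf (law n). \<forall>k\<in>{1..n}. deg G k \<le> j \<longrightarrow>
        \<bar>expect (rule (Suc n) G) (\<lambda>ws. count (mset ws) k) - c (deg G k) / n\<bar> \<le> \<epsilon> n G / n \<and>
        expect (rule (Suc n) G) (\<lambda>ws. real (count (mset ws) k) * (real (count (mset ws) k) - 1)) \<le> \<epsilon> n G / n"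
    using local[of j] by blast
  define b where "b n = of_bool (j = m) + (if j = 0 then 0 else c (j - 1) * (N (j - 1) n / n))" for n
  have "(\<lambda>n. N j n / real n) \<longlonglongrightarrow> p j"
  proof (rule averaged_recursion_tendsto[where c = "c j" and b = b and e = "\<lambda>n. 2 * expect (law n) (\<epsilon> n)"])
    show "b \<longlonglongrightarrow> (1 + c j) * p j"
    proof (cases "j = 0")
      case False
      then have "(\<lambda>n. N (j - 1) n / real n) \<longlonglongrightarrow> p (j - 1)"
        using less[of "j - 1"] by (simp add: N_def)
      then have "b \<longlonglongrightarrow> of_bool (j = m) + c (j - 1) * p (j - 1)"
        using False unfolding b_def if_not_P[OF False] by (intro tendsto_intros)
      then show ?thesis using False p[of j] by simp
    next
      case True
      then have "b = (\<lambda>_. of_bool (j = m))" by (simp add: fun_eq_iff b_def)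
      then show ?thesis using True p[of j] by simp
    qed
    show "(\<lambda>n. 2 * expect (law n) (\<epsilon> n)) \<longlonglongrightarrow> 0"
      using tendsto_mult[OF tendsto_const[of 2] \<epsilon>] by simp
    show "\<forall>\<^sub>F n in sequentially. \<bar>N j (Suc n) - ((1 - c j / real n) * N j n + b n)\<bar> \<le> 2 * expect (law n) (\<epsilon> n)"
      using ev eventually_ge_at_top[of s]
    proof eventually_elim
      case (elim n)
      define R where "R G = (1 - c j / n) * degree_count n j G
        + (of_bool (j = m) + (if j = 0 then 0 else c (j - 1) / n * degree_count n (j - 1) G))" for G
      have "\<bar>N j (Suc n) - expect (law n) R\<bar> \<le> expect (law n) (\<lambda>G. 2 * \<epsilon> n G)"
        unfolding N_def expect_law_Suc[OF elim(2)]
      proof (intro expect_abs_diff_le finite_law)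
        fix G assume G: "G \<in> set_pmf (law n)"
        show "\<bar>expect (rule (Suc n) G) (\<lambda>ws. degree_count (Suc n) j (attach G (Suc n) ws)) - R G\<bar> \<le> 2 * \<epsilon> n G"
          unfolding R_def
          by (rule expected_degree_count_attach)
             (use elim s G law_grown[OF elim(2) G] finite_rule[OF elim(2) G] rule[OF elim(2) G] \<epsilon>0
              in \<open>auto simp: grown_def\<close>)
      qed
      moreover have "expect (law n) R = (1 - c j / real n) * N j n + b n"
      proof -
        define t where "t = (if j = 0 then 0 else c (j - 1) / n)"
        have "R = (\<lambda>G. ((1 - c j / n) * degree_count n j G + t * degree_count n (j - 1) G) + of_bool (j = m))"
          by (auto simp: fun_eq_iff R_def t_def)
        then have "expect (law n) R = ((1 - c j / n) * N j n + t * N (j - 1) n) + of_bool (j = m)"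
          unfolding N_def by (simp only: expect_add[OF finite_law] integral_mult_right_zero) simp
        then show ?thesis by (simp add: b_def t_def)
      qed
      ultimately show ?case by simp
    qed
  qed (rule c)
  then show ?case by (simp add: N_def)
qed

end

section \<open>The degree of a random receiver\<close>

lemma deg_conv_receivers: "deg G k = size (receivers G k) + count (image_mset snd G) k"
proof -
  have "count (image_mset fst G) k = size (receivers G k)"
    by (subst count_conv_size_mset) (simp add: filter_mset_image_mset receivers_def eq_commute)
  then show ?thesis by (simp add: deg_def endpoints_def)
qed

text \<open>
  Both sides count the edges from \<open>A\<close> to \<open>k\<close>.
\<close>

lemma sum_count_receivers:
  assumes "finite A"
  shows "(\<Sum>v\<in>A. count (receivers G v) k) = count (image_mset snd (filter_mset (\<lambda>e. fst e \<in> A) G)) k"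
proof (induction G)
  case (add e G)
  have "(\<Sum>v\<in>A. count (receivers (add_mset e G) v) k)
      = (\<Sum>v\<in>A. count (receivers G v) k + (if v = fst e then of_bool (snd e = k) else 0))"
    by (intro sum.cong) (auto simp: receivers_def)
  also have "\<dots> = (\<Sum>v\<in>A. count (receivers G v) k) + (if fst e \<in> A then of_bool (snd e = k) else 0)"
    using assms by (simp add: sum.distrib)
  finally show ?case using add by auto
qed (simp add: receivers_def)

lemma received_le_deg: "(\<Sum>v\<in>{s<..n}. count (receivers G v) k) \<le> deg G k"
proof -
  have "image_mset snd (filter_mset (\<lambda>e. fst e \<in> {s<..n}) G) \<subseteq># image_mset snd G"
    by (intro image_mset_subseteq_mono) simp
  from mset_subset_eq_count[OF this, of k] show ?thesis
    by (simp add: sum_count_receivers deg_conv_receivers)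
qed

text \<open>
  A later vertex sends out \<open>m\<close> edges and is not met by the initial graph, so all its other edges are
  received ones.
\<close>

lemma received_eq_deg:
  assumes G: "grown m s H n G" and H: "set_mset H \<subseteq> {1..s} \<times> {1..s}" and k: "k \<in> {s<..n}"
  shows "(\<Sum>v\<in>{s<..n}. count (receivers G v) k) + m = deg G k"
proof -
  have "filter_mset (\<lambda>e. fst e \<notin> {s<..n}) G = filter_mset (\<lambda>e. fst e \<le> s) G"
    using G by (intro filter_mset_cong refl) (auto simp: grown_def)
  also have "\<dots> = H" using G by (simp add: grown_def)
  finally have "G = filter_mset (\<lambda>e. fst e \<in> {s<..n}) G + H"
    using multiset_partition[of G "\<lambda>e. fst e \<in> {s<..n}"] by simp
  then have "count (image_mset snd G) k
      = count (image_mset snd (filter_mset (\<lambda>e. fst e \<in> {s<..n}) G)) k + count (image_mset snd H) k"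
    by (metis count_union image_mset_union)
  moreover have "count (image_mset snd H) k = 0"
    using H k by (force simp: count_eq_zero_iff)
  moreover have "size (receivers G k) = m" using G k by (simp add: grown_def)
  ultimately show ?thesis
    by (simp add: sum_count_receivers deg_conv_receivers)
qed

context attachment_process
begin

text \<open>
  Choosing a vertex and then one of its \<open>m\<close> edges is choosing an edge uniformly. Sorting these edges
  by the vertex that receives them, each non-initial vertex of degree \<open>j\<close> accounts for exactly
  \<open>j - m\<close> of them. Thus the law of the receiver's degree is determined by the degree counts alone,
  without any knowledge of how the degrees of adjacent vertices are correlated. The boundedly many
  initial vertices contribute \<open>O(1 / n)\<close>, both as sources and as receivers.
\<close>

theorem pmf_receiver_degree_tendsto:
  assumes lim: "(\<lambda>n. expect (law n) (degree_count n j) / n) \<longlonglongrightarrow> q"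
  shows "(\<lambda>n. pmf (bind_pmf (law n) (\<lambda>G. bind_pmf (pmf_of_set {1..n}) (\<lambda>v.
      if v \<le> s then return_pmf (d v)
      else map_pmf (deg G) (pmf_of_multiset (receivers G v))))) j)
    \<longlonglongrightarrow> (real j - real m) / m * q"
proof -
  define K where "K G v = (if v \<le> s then return_pmf (d v)
      else map_pmf (deg G) (pmf_of_multiset (receivers G v)))" for G v
  let ?P = "\<lambda>n. pmf (bind_pmf (law n) (\<lambda>G. bind_pmf (pmf_of_set {1..n}) (K G))) j"
  let ?q = "\<lambda>n. expect (law n) (degree_count n j) / n"
  define B where "B = real s + real s * (real j + real m)"
  have bound: "\<bar>?P n - (real j - real m) / m * ?q n\<bar> \<le> B / n" if n: "n \<ge> s" for n
  proof -
    have n0: "n > 0" using n s by simp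
    have "?P n = expect (law n) (\<lambda>G. (\<Sum>v\<in>{1..n}. pmf (K G v) j) / n)"
      using n0 by (simp add: pmf_bind integral_pmf_of_set)
    moreover have "\<bar>expect (law n) (\<lambda>G. (\<Sum>v\<in>{1..n}. pmf (K G v) j) / n)
        - expect (law n) (\<lambda>G. (real j - real m) / m * (degree_count n j G / n))\<bar> \<le> expect (law n) (\<lambda>_. B / n)"
    proof (intro expect_abs_diff_le finite_law)
      fix G assume "G \<in> set_pmf (law n)"
      then have G: "grown m s H n G" by (rule law_grown[OF n])
      have sub: "set_mset G \<subseteq> {1..n} \<times> {1..n}" using G by (simp add: grown_def)
      let ?I = "\<lambda>k. of_bool (deg G k = j) :: real"
      let ?R = "\<lambda>k. real (\<Sum>v\<in>{s<..n}. count (receivers G v) k)"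
      have old: "pmf (K G v) j = (\<Sum>k\<in>{1..n}. ?I k * count (receivers G v) k) / m" if v: "v \<in> {s<..n}" for v
      proof -
        have sz: "size (receivers G v) = m" using G v by (simp add: grown_def)
        then have ne: "receivers G v \<noteq> {#}" using m by auto
        have "pmf (K G v) j = expect (pmf_of_multiset (receivers G v)) ?I"
          using v by (simp add: K_def map_pmf_def pmf_bind indicator_def of_bool_def)
        also have "\<dots> = (\<Sum>k\<in>{1..n}. ?I k * pmf (pmf_of_multiset (receivers G v)) k)"
          using sub ne by (intro integral_measure_pmf_real) (auto simp: receivers_def)
        also have "\<dots> = (\<Sum>k\<in>{1..n}. ?I k * count (receivers G v) k) / m"
          using sz ne by (simp add: sum_divide_distrib del: sum_of_bool_mult_eq sum_mult_of_bool_eq)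
        finally show ?thesis .
      qed
      have "(\<Sum>v\<in>{1..n}. pmf (K G v) j) = (\<Sum>v\<in>{1..s}. pmf (K G v) j) + (\<Sum>v\<in>{s<..n}. pmf (K G v) j)"
        using n by (subst sum.union_disjoint[symmetric]) (auto intro!: sum.cong)
      \<comment> \<open>Double counting of the edges: from sources to receivers.\<close>
      also have "(\<Sum>v\<in>{s<..n}. pmf (K G v) j) = (\<Sum>k\<in>{1..n}. ?I k * ?R k) / m"
      proof -
        have "(\<Sum>v\<in>{s<..n}. pmf (K G v) j) = (\<Sum>v\<in>{s<..n}. \<Sum>k\<in>{1..n}. ?I k * count (receivers G v) k) / m"
          unfolding sum_divide_distrib[of _ "{s<..n}"] by (intro sum.cong refl old)
        also have "(\<Sum>v\<in>{s<..n}. \<Sum>k\<in>{1..n}. ?I k * count (receivers G v) k)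
            = (\<Sum>k\<in>{1..n}. ?I k * ?R k)"
          unfolding of_nat_sum sum_distrib_left by (rule sum.swap)
        finally show ?thesis .
      qed
      finally have S: "(\<Sum>v\<in>{1..n}. pmf (K G v) j) = (\<Sum>v\<in>{1..s}. pmf (K G v) j) + (\<Sum>k\<in>{1..n}. ?I k * ?R k) / m" .
      have D: "(real j - real m) * degree_count n j G = (\<Sum>k\<in>{1..n}. ?I k * (real j - real m))"
        by (simp only: degree_count_def sum_distrib_left mult.commute)
      have "\<bar>\<Sum>v\<in>{1..s}. pmf (K G v) j\<bar> \<le> real s"
        using sum_bounded_above[of "{1..s}" "\<lambda>v. pmf (K G v) j" 1]
        by (simp add: sum_nonneg pmf_le_1)
      moreover have "\<bar>(\<Sum>k\<in>{1..n}. ?I k * ?R k) / m - (real j - real m) / m * degree_count n j G\<bar> \<le> real s * (real j + real m)"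
      proof -
        have "(\<Sum>k\<in>{1..n}. ?I k * ?R k) - (real j - real m) * degree_count n j G
            = (\<Sum>k\<in>{1..n}. ?I k * (?R k - (real j - real m)))"
          unfolding D sum_subtractf[symmetric] by (intro sum.cong) (auto simp: algebra_simps)
        also have "\<dots> = (\<Sum>k\<in>{1..s}. ?I k * (?R k - (real j - real m)))"
        proof (rule sum.mono_neutral_right)
          show "\<forall>k\<in>{1..n} - {1..s}. ?I k * (?R k - (real j - real m)) = 0"
          proof
            fix k assume "k \<in> {1..n} - {1..s}"
            then have "(\<Sum>v\<in>{s<..n}. count (receivers G v) k) + m = deg G k"
              using received_eq_deg[OF G H, of k] by auto
            then have "?R k + m = real (deg G k)" by (simp only: of_nat_add[symmetric])
            then show "?I k * (?R k - (real j - real m)) = 0" by (auto simp: of_bool_def)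
          qed
        qed (use n in auto)
        also have "\<bar>\<dots>\<bar> \<le> (\<Sum>k\<in>{1..s}. real j + real m)"
        proof (intro order_trans[OF sum_abs] sum_mono)
          fix k
          have "?R k \<le> real (deg G k)" by (intro of_nat_mono received_le_deg)
          moreover have "?R k \<ge> 0" by (rule of_nat_0_le_iff)
          ultimately show "\<bar>?I k * (?R k - (real j - real m))\<bar> \<le> real j + real m"
            unfolding of_bool_def abs_le_iff by (simp del: of_nat_sum)
        qed
        finally have "\<bar>(\<Sum>k\<in>{1..n}. ?I k * ?R k) - (real j - real m) * degree_count n j G\<bar> \<le> real s * (real j + real m)"
          by simp
        then have "\<bar>(\<Sum>k\<in>{1..n}. ?I k * ?R k) - (real j - real m) * degree_count n j G\<bar> / m \<le> real s * (real j + real m) / 1"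
          using m by (intro frac_le) auto
        then show ?thesis by (simp add: diff_divide_distrib[symmetric])
      qed
      ultimately have "\<bar>(\<Sum>v\<in>{1..n}. pmf (K G v) j) - (real j - real m) / m * degree_count n j G\<bar> \<le> B"
        unfolding S B_def by linarith
      then have "\<bar>(\<Sum>v\<in>{1..n}. pmf (K G v) j) - (real j - real m) / m * degree_count n j G\<bar> / n \<le> B / n"
        by (intro divide_right_mono) auto
      then show "\<bar>(\<Sum>v\<in>{1..n}. pmf (K G v) j) / n - (real j - real m) / m * (degree_count n j G / n)\<bar> \<le> B / n"
        by (simp only: times_divide_eq_right diff_divide_distrib[symmetric] abs_divide abs_of_nat)
    qed
    ultimately show ?thesis by simp
  qed
  have "(\<lambda>n. ?P n - (real j - real m) / m * ?q n) \<longlonglongrightarrow> 0"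
  proof (rule Lim_null_comparison)
    show "\<forall>\<^sub>F n in sequentially. norm (?P n - (real j - real m) / m * ?q n) \<le> B / n"
      using eventually_ge_at_top[of s] by eventually_elim (use bound in simp)
    show "(\<lambda>n. B / real n) \<longlonglongrightarrow> 0" by real_asymp
  qed
  from tendsto_add[OF this tendsto_mult[OF tendsto_const[of "(real j - real m) / m"] lim]] show ?thesis
    unfolding K_def by simp
qed

lemma pmf_degree_tendsto:
  assumes lim: "(\<lambda>n. expect (law n) (degree_count n j) / n) \<longlonglongrightarrow> q"
  shows "(\<lambda>n. pmf (bind_pmf (law n) (\<lambda>G. bind_pmf (pmf_of_set {1..n}) (\<lambda>v. return_pmf (deg G v)))) j) \<longlonglongrightarrow> q"
proof (rule Lim_transform_eventually[OF lim])
  show "\<forall>\<^sub>F n in sequentially. expect (law n) (degree_count n j) / n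
    = pmf (bind_pmf (law n) (\<lambda>G. bind_pmf (pmf_of_set {1..n}) (\<lambda>v. return_pmf (deg G v)))) j"
    using eventually_ge_at_top[of 1]
    by eventually_elim
      (simp add: pmf_bind integral_pmf_of_set degree_count_def[abs_def] indicator_def of_bool_def)
qed

end

section \<open>The limiting distributions\<close>

text \<open>
  On the natural numbers each value of a distribution function is a finite sum of point probabilities.
\<close>

lemma converges_in_distributionI:
  assumes "\<And>j. (\<lambda>n. pmf (X n) j) \<longlonglongrightarrow> pmf L j"
  shows "converges_in_distribution X L"
proof -
  have fin: "finite {j. real j \<le> x}" for x :: real
    by (rule finite_subset[of _ "{..nat \<lceil>x\<rceil>}"]) (auto dest: order_trans[OF _ real_nat_ceiling_ge])
  have cdf: "cdf (distr (measure_pmf p) borel real) x = (\<Sum>j\<in>{j. real j \<le> x}. pmf p j)" for p x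
    using measure_measure_pmf_finite[OF fin, of p x]
    by (simp add: cdf_def measure_distr vimage_def atMost_def)
  show ?thesis
    unfolding converges_in_distribution_def weak_conv_m_def weak_conv_def cdf
    by (intro allI impI tendsto_sum assms)
qed

lemma pmf_of_sums_1:
  fixes f :: "nat \<Rightarrow> real"
  assumes "\<And>k. f k \<ge> 0" and "f sums 1"
  obtains P where "\<And>k. k < m \<Longrightarrow> pmf P k = 0" and "\<And>k. pmf P (m + k) = f k"
proof -
  define g where "g j = (if j < m then 0 else f (j - m))" for j
  have g: "g sums 1"
    by (subst sums_zero_iff_shift[of m, symmetric]) (use assms(2) in \<open>auto simp: g_def\<close>)
  have nn: "(\<integral>\<^sup>+ x. ennreal (g x) \<partial>count_space UNIV) = 1"
    using g assms(1) by (subst nn_integral_count_space_nat, subst suminf_ennreal2)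
      (auto simp: g_def sums_iff)
  have "pmf (embed_pmf g) j = g j" for j
    using nn assms(1) by (intro pmf_embed_pmf) (auto simp: g_def)
  then show ?thesis by (intro that[of "embed_pmf g"]) (auto simp: g_def)
qed

text \<open>
  The two limits with the parameter \<open>b = 1 / \<psi>\<close>.
\<close>

definition degree_limit :: "real \<Rightarrow> real \<Rightarrow> nat \<Rightarrow> real" where
  "degree_limit a b k = (b + 1) * (Gamma (a + b + 1) / Gamma a) * (Gamma (real k + a) / Gamma (a + b + real k + 2))"

definition receiver_limit :: "real \<Rightarrow> real \<Rightarrow> nat \<Rightarrow> real" where
  "receiver_limit a b k = b * (b + 1) * (Gamma (a + b + 1) / Gamma (a + 1))
     * ((real k + 1) * Gamma (real k + a + 1) / Gamma (a + b + real k + 3))"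

lemma Gamma_add_1: "x > 0 \<Longrightarrow> Gamma (x + 1) = x * Gamma (x :: real)"
  by (intro Gamma_plus1) (auto simp: nonpos_Ints_def)

context
  fixes a b :: real
  assumes a: "a > 0" and b: "b > 0"
begin

lemma degree_limit_nonneg: "degree_limit a b k \<ge> 0"
  using a b unfolding degree_limit_def
  by (intro mult_nonneg_nonneg divide_nonneg_nonneg less_imp_le[OF Gamma_real_pos]) auto

lemma receiver_limit_nonneg: "receiver_limit a b k \<ge> 0"
  using a b unfolding receiver_limit_def
  by (intro mult_nonneg_nonneg divide_nonneg_nonneg less_imp_le[OF Gamma_real_pos]) auto

lemma degree_limit_sums: "degree_limit a b sums 1"
proof -
  have "(\<lambda>k. Gamma (real k + a) / Gamma (real k + a + (b + 1) + 1)) sums (Gamma a / ((b + 1) * Gamma (a + (b + 1))))"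
    using a b by (intro Gamma_quotient_sums) auto
  from sums_mult[OF this, of "(b + 1) * (Gamma (a + b + 1) / Gamma a)"]
  have "degree_limit a b sums ((b + 1) * (Gamma (a + b + 1) / Gamma a) * (Gamma a / ((b + 1) * Gamma (a + (b + 1)))))"
    by (simp add: degree_limit_def[abs_def] add_ac)
  moreover have "Gamma a > 0" "Gamma (a + b + 1) > 0" using a b by (auto intro!: Gamma_real_pos)
  ultimately show ?thesis using b by (simp add: add_ac)
qed

text \<open>
  Writing \<open>k + 1 = (k + a + 1) - a\<close> splits the series into two that telescope.
\<close>

lemma receiver_limit_sums: "receiver_limit a b sums 1"
proof -
  define G where "G = Gamma (a + b + 1)"
  define A where "A = Gamma (a + 1)"
  have pos: "G > 0" "A > 0" using a b by (auto simp: G_def A_def intro!: Gamma_real_pos)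
  have 1: "(\<lambda>k. Gamma (real k + (a + 2)) / Gamma (real k + (a + 2) + b + 1)) sums (Gamma (a + 2) / (b * Gamma (a + 2 + b)))"
    using a b by (intro Gamma_quotient_sums) auto
  have 2: "(\<lambda>k. Gamma (real k + (a + 1)) / Gamma (real k + (a + 1) + (b + 1) + 1)) sums (Gamma (a + 1) / ((b + 1) * Gamma (a + 1 + (b + 1))))"
    using a b by (intro Gamma_quotient_sums) auto
  have split: "Gamma (real k + (a + 2)) / Gamma (real k + (a + 2) + b + 1) - a * (Gamma (real k + (a + 1)) / Gamma (real k + (a + 1) + (b + 1) + 1))
      = (real k + 1) * Gamma (real k + a + 1) / Gamma (a + b + real k + 3)" for k
  proof -
    have "Gamma (real k + (a + 2)) = (real k + a + 1) * Gamma (real k + a + 1)"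
      using Gamma_add_1[of "real k + a + 1"] a by (simp add: add_ac)
    moreover have "real k + (a + 2) + b + 1 = a + b + real k + 3" "real k + (a + 1) + (b + 1) + 1 = a + b + real k + 3"
      "real k + (a + 1) = real k + a + 1" by simp_all
    ultimately show ?thesis by (simp add: diff_divide_distrib[symmetric] algebra_simps)
  qed
  have val: "Gamma (a + 2) / (b * Gamma (a + 2 + b)) - a * (Gamma (a + 1) / ((b + 1) * Gamma (a + 1 + (b + 1))))
      = A / (b * (b + 1) * G)"
  proof -
    have "Gamma (a + 2) = (a + 1) * A" using Gamma_add_1[of "a + 1"] a by (simp add: A_def add_ac)
    moreover have "Gamma (a + 2 + b) = (a + b + 1) * G" "Gamma (a + 1 + (b + 1)) = (a + b + 1) * G"
      using Gamma_add_1[of "a + b + 1"] a b by (simp_all add: G_def add_ac)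
    moreover have "(a + 1) * A / (b * ((a + b + 1) * G)) - a * (A / ((b + 1) * ((a + b + 1) * G))) = A / (b * (b + 1) * G)"
    proof -
      have nz: "b \<noteq> 0" "b + 1 \<noteq> 0" "a + b + 1 \<noteq> 0" "G \<noteq> 0" using a b pos by auto
      have e1: "(a + 1) * A / (b * ((a + b + 1) * G)) = (a + 1) * (b + 1) * A / (b * (b + 1) * (a + b + 1) * G)"
        using nz by simp
      have e2: "a * (A / ((b + 1) * ((a + b + 1) * G))) = a * b * A / (b * (b + 1) * (a + b + 1) * G)"
        using nz by simp
      have e3: "(a + 1) * (b + 1) * A - a * b * A = (a + b + 1) * A" by (simp add: algebra_simps)
      show ?thesis unfolding e1 e2 diff_divide_distrib[symmetric] e3 using nz by simp
    qed
    ultimately show ?thesis by (simp add: A_def)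
  qed
  from sums_mult[OF sums_diff[OF 1 sums_mult[OF 2, of a], unfolded split val], of "b * (b + 1) * (G / A)"]
  have "receiver_limit a b sums (b * (b + 1) * (G / A) * (A / (b * (b + 1) * G)))"
    by (simp only: receiver_limit_def[abs_def] G_def A_def)
  then show ?thesis using pos b by simp
qed

lemma degree_limit_0: "(a + b + 1) * degree_limit a b 0 = b + 1"
proof -
  have "Gamma (a + b + 2) = (a + b + 1) * Gamma (a + b + 1)"
    using Gamma_add_1[of "a + b + 1"] a b by (simp add: add_ac)
  moreover have "Gamma a \<noteq> 0" "Gamma (a + b + 1) \<noteq> 0" "a + b + 1 \<noteq> 0"
    using Gamma_real_pos[of a] Gamma_real_pos[of "a + b + 1"] a b
    by (simp_all add: less_imp_neq[symmetric])
  ultimately show ?thesis by (simp add: degree_limit_def)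
qed

lemma degree_limit_Suc:
  "(a + b + real k + 2) * degree_limit a b (Suc k) = (real k + a) * degree_limit a b k"
proof -
  have 1: "Gamma (a + b + real (Suc k) + 2) = (a + b + real k + 2) * Gamma (a + b + real k + 2)"
    using Gamma_add_1[of "a + b + real k + 2"] a b by (simp add: add_ac)
  have 2: "Gamma (real (Suc k) + a) = (real k + a) * Gamma (real k + a)"
    using Gamma_add_1[of "real k + a"] a by (simp add: add_ac)
  have "a + b + real k + 2 > 0" using a b by simp
  then show ?thesis unfolding degree_limit_def 1 2 by simp
qed

text \<open>
  For \<open>a = m * b\<close> the factor is \<open>(k + 1) / m\<close>: this is the size bias \<open>(j - m) / m\<close> at
  \<open>j = m + 1 + k\<close>.
\<close>

lemma receiver_limit_conv: "receiver_limit a b k = b * (real k + 1) / a * degree_limit a b (Suc k)"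
proof -
  have "Gamma (a + 1) = a * Gamma a" using a by (rule Gamma_add_1)
  then show ?thesis using a
    by (simp add: receiver_limit_def degree_limit_def add_ac mult_ac)
qed

end

section \<open>Choosing a receiver\<close>

lemma size_endpoints: "size (endpoints G) = 2 * size G"
  by (simp add: endpoints_def)

lemma set_endpoints: "set_mset G \<subseteq> A \<times> A \<Longrightarrow> set_mset (endpoints G) \<subseteq> A"
  by (auto simp: endpoints_def)

lemma pmf_pick:
  assumes "0 \<le> q" "q \<le> 1" "n > 0" "E \<noteq> {#}" "k \<in> {1..n}"
  shows "pmf (pick q (Suc n) E) k = q / n + (1 - q) * count E k / size E"
  using assms by (simp add: pick_def pmf_bind atLeastLessThanSuc_atLeastAtMost)

lemma set_pick:
  assumes "n > 0" "E \<noteq> {#}" "set_mset E \<subseteq> {1..n}"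
  shows "set_pmf (pick q (Suc n) E) \<subseteq> {1..n}"
  using assms by (auto simp: pick_def atLeastLessThanSuc_atLeastAtMost split: if_splits)

lemma expect_of_bool_eq: "expect p (\<lambda>w. of_bool (w = k) * g w) = pmf p k * g k"
  by (subst integral_measure_pmf_real[of "{k}"]) (auto split: if_splits)

lemma attachment_processI:
  assumes "m \<ge> 1" "s \<ge> 1" "set_mset H \<subseteq> {1..s} \<times> {1..s}"
    and rule: "\<And>n G ws. n \<ge> s \<Longrightarrow> grown m s H n G \<Longrightarrow> ws \<in> set_pmf (rule (Suc n) G) \<Longrightarrow>
      length ws = m \<and> set ws \<subseteq> {1..n}"
  shows "attachment_process m s H rule"
proof
  fix n G ws assume n: "n \<ge> s" and G: "G \<in> set_pmf (grow s H rule n)" and ws: "ws \<in> set_pmf (rule (Suc n) G)"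
  have "grown m s H n G"
  proof (rule set_grow_invariant[where P = "grown m s H" and rule = rule, OF _ _ n G])
    show "grown m s H s H" by (rule grown_initial[OF assms(3)])
    show "grown m s H (Suc n) (attach G (Suc n) ws)"
      if "s \<le> n" "grown m s H n G" "ws \<in> set_pmf (rule (Suc n) G)" for n G ws
      using rule[OF that] that by (intro grown_attach) auto
  qed
  then show "length ws = m \<and> set ws \<subseteq> {1..n}" using rule n ws by blast
qed (use assms in auto)

text \<open>
  A vertex of degree \<open>d\<close> among \<open>n\<close> vertices is hit by each of the \<open>m\<close> new edges with probability
  about \<open>\<alpha> / n + (1 - \<alpha>) * d / (2 * m * n)\<close>; this is \<open>n\<close> times the expected number of hits.
\<close>

definition attach_rate :: "nat \<Rightarrow> real \<Rightarrow> nat \<Rightarrow> real" where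
  "attach_rate m \<alpha> d = m * \<alpha> + (1 - \<alpha>) * d / 2"

lemma attach_rate_nonneg: "0 \<le> \<alpha> \<Longrightarrow> \<alpha> \<le> 1 \<Longrightarrow> 0 \<le> attach_rate m \<alpha> d"
  by (simp add: attach_rate_def)

context attachment_process
begin

text \<open>
  The situation of the independent and the sequential model, where the error is deterministic.
\<close>

lemma expected_degree_count_limit_of_rate:
  fixes c p :: "nat \<Rightarrow> real"
  assumes c: "\<And>j. c j \<ge> 0"
    and p: "\<And>j. (1 + c j) * p j = of_bool (j = m) + (if j = 0 then 0 else c (j - 1) * p (j - 1))"
    and rate: "\<And>j. \<exists>K n0. \<forall>n\<ge>n0. \<forall>G\<in>set_pmf (law n). \<forall>k\<in>{1..n}. deg G k \<le> j \<longrightarrow>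
        \<bar>expect (rule (Suc n) G) (\<lambda>ws. count (mset ws) k) - c (deg G k) / n\<bar> \<le> K / real n ^ 2 \<and>
        expect (rule (Suc n) G) (\<lambda>ws. real (count (mset ws) k) * (real (count (mset ws) k) - 1)) \<le> K / real n ^ 2"
  shows "(\<lambda>n. expect (law n) (degree_count n j) / n) \<longlonglongrightarrow> p j"
proof (rule expected_degree_count_limit[OF c p])
  fix j
  obtain K n0 where K: "\<And>n G k. n \<ge> n0 \<Longrightarrow> G \<in> set_pmf (law n) \<Longrightarrow> k \<in> {1..n} \<Longrightarrow> deg G k \<le> j \<Longrightarrow>
        \<bar>expect (rule (Suc n) G) (\<lambda>ws. count (mset ws) k) - c (deg G k) / n\<bar> \<le> K / real n ^ 2 \<and>
        expect (rule (Suc n) G) (\<lambda>ws. real (count (mset ws) k) * (real (count (mset ws) k) - 1)) \<le> K / real n ^ 2"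
    using rate[of j] by blast
  define \<epsilon> where "\<epsilon> n (G :: mgraph) = \<bar>K\<bar> / real n" for n G
  have le: "K / real n ^ 2 \<le> \<epsilon> n G / n" for n G
    by (simp add: \<epsilon>_def power2_eq_square divide_right_mono)
  show "\<exists>\<epsilon>. (\<forall>n G. 0 \<le> \<epsilon> n G) \<and> (\<lambda>n. expect (law n) (\<epsilon> n)) \<longlonglongrightarrow> 0 \<and>
      (\<forall>\<^sub>F n in sequentially. \<forall>G\<in>set_pmf (law n). \<forall>k\<in>{1..n}. deg G k \<le> j \<longrightarrow>
        \<bar>expect (rule (Suc n) G) (\<lambda>ws. count (mset ws) k) - c (deg G k) / n\<bar> \<le> \<epsilon> n G / n \<and>
        expect (rule (Suc n) G) (\<lambda>ws. real (count (mset ws) k) * (real (count (mset ws) k) - 1)) \<le> \<epsilon> n G / n)"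
  proof (intro exI[of _ \<epsilon>] conjI)
    show "(\<lambda>n. expect (law n) (\<epsilon> n)) \<longlonglongrightarrow> 0"
      unfolding \<epsilon>_def by (simp, real_asymp)
    show "\<forall>\<^sub>F n in sequentially. \<forall>G\<in>set_pmf (law n). \<forall>k\<in>{1..n}. deg G k \<le> j \<longrightarrow>
        \<bar>expect (rule (Suc n) G) (\<lambda>ws. count (mset ws) k) - c (deg G k) / n\<bar> \<le> \<epsilon> n G / n \<and>
        expect (rule (Suc n) G) (\<lambda>ws. real (count (mset ws) k) * (real (count (mset ws) k) - 1)) \<le> \<epsilon> n G / n"
      using eventually_ge_at_top[of n0]
      by eventually_elim (use K le order_trans in blast)
  qed (simp add: \<epsilon>_def)
qed

end

section \<open>Independent choices\<close>

lemma finite_replicate_pmf: "finite (set_pmf p) \<Longrightarrow> finite (set_pmf (replicate_pmf n p))"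
  using finite_lists_length_eq[of "set_pmf p" n] by (simp add: set_replicate_pmf lists_eq_set)

lemma expect_replicate_Suc:
  assumes "finite (set_pmf p)"
  shows "expect (replicate_pmf (Suc n) p) f = expect p (\<lambda>w. expect (replicate_pmf n p) (\<lambda>ws. f (w # ws)))"
  using assms finite_replicate_pmf[OF assms, of n]
  by (simp add: expect_bind)

text \<open>
  By exchangeability, each of the \<open>n\<close> draws equal to \<open>k\<close> may be taken to be the first one. The
  identity yields both factorial moments of the count and, with \<open>f\<close> the indicator of multisets
  without repetition, the mean of the count under the distinctness condition.
\<close>

lemma expect_replicate_count:
  assumes fin: "finite (set_pmf p)"
  shows "expect (replicate_pmf n p) (\<lambda>ws. real (count (mset ws) k) * f (mset ws))
    = n * pmf p k * expect (replicate_pmf (n - 1) p) (\<lambda>ws. f (add_mset k (mset ws)))"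
proof (induction n arbitrary: f)
  case (Suc n)
  let ?E = "\<lambda>n f. expect (replicate_pmf n p) (\<lambda>ws. f (mset ws))"
  note [simp] = finite_replicate_pmf[OF fin]
  have "expect (replicate_pmf (Suc n) p) (\<lambda>ws. real (count (mset ws) k) * f (mset ws))
      = expect p (\<lambda>w. of_bool (w = k) * ?E n (\<lambda>M. f (add_mset w M))
          + expect (replicate_pmf n p) (\<lambda>ws. real (count (mset ws) k) * f (add_mset w (mset ws))))"
    unfolding expect_replicate_Suc[OF fin]
  proof (rule expect_cong)
    fix w
    have "expect (replicate_pmf n p) (\<lambda>ws. real (count (mset (w # ws)) k) * f (mset (w # ws)))
        = expect (replicate_pmf n p) (\<lambda>ws. of_bool (w = k) * f (add_mset w (mset ws))
            + real (count (mset ws) k) * f (add_mset w (mset ws)))"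
      by (rule expect_cong) (auto simp: algebra_simps)
    then show "expect (replicate_pmf n p) (\<lambda>ws. real (count (mset (w # ws)) k) * f (mset (w # ws)))
        = of_bool (w = k) * ?E n (\<lambda>M. f (add_mset w M))
          + expect (replicate_pmf n p) (\<lambda>ws. real (count (mset ws) k) * f (add_mset w (mset ws)))"
      by (simp add: expect_add)
  qed
  also have "\<dots> = pmf p k * ?E n (\<lambda>M. f (add_mset k M))
      + expect p (\<lambda>w. n * pmf p k * ?E (n - 1) (\<lambda>M. f (add_mset w (add_mset k M))))"
    by (simp only: expect_add[OF fin] expect_of_bool_eq Suc.IH[of "\<lambda>M. f (add_mset _ M)"])
  also have "expect p (\<lambda>w. n * pmf p k * ?E (n - 1) (\<lambda>M. f (add_mset w (add_mset k M))))
      = n * pmf p k * ?E n (\<lambda>M. f (add_mset k M))"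
  proof (cases n)
    case (Suc l)
    then show ?thesis
      by (simp add: expect_replicate_Suc[OF fin] add_mset_commute del: replicate_pmf.simps)
  qed simp
  finally show ?case by (simp add: algebra_simps)
qed simp

lemma expect_replicate_count_1:
  assumes "finite (set_pmf p)"
  shows "expect (replicate_pmf n p) (\<lambda>ws. real (count (mset ws) k)) = n * pmf p k"
  using expect_replicate_count[OF assms, of n k "\<lambda>_. 1"] by simp

lemma expect_replicate_count_2:
  assumes fin: "finite (set_pmf p)"
  shows "expect (replicate_pmf n p) (\<lambda>ws. real (count (mset ws) k) * (real (count (mset ws) k) - 1))
    = n * real (n - 1) * (pmf p k)\<^sup>2"
  using expect_replicate_count[OF fin, of n k "\<lambda>M. real (count M k) - 1"]
  by (simp add: expect_replicate_count_1[OF fin] power2_eq_square)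

lemma attachment_process_indep:
  assumes m: "m \<ge> 1"
  shows "attachment_process m 1 {#} (indep_rule m \<alpha>)"
proof (rule attachment_processI)
  fix n G ws
  assume n: "n \<ge> 1" and G: "grown m 1 {#} n G" and ws: "ws \<in> set_pmf (indep_rule m \<alpha> (Suc n) G)"
  show "length ws = m \<and> set ws \<subseteq> {1..n}"
  proof (cases "n = 1")
    case True
    then show ?thesis using ws by (auto simp: indep_rule_def)
  next
    case False
    then have "size (endpoints G) > 0" using G m n by (simp add: grown_def size_endpoints)
    then have "set_pmf (pick \<alpha> (Suc n) (endpoints G)) \<subseteq> {1..n}"
      using G n by (intro set_pick set_endpoints) (auto simp: grown_def)
    then show ?thesis using ws False n by (auto simp: indep_rule_def set_replicate_pmf)
  qed
qed (use m in auto)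

lemma rate_indep:
  fixes \<alpha> :: real
  assumes m: "m \<ge> 1" and \<alpha>: "0 \<le> \<alpha>" "\<alpha> < 1" and n: "n \<ge> 2"
    and G: "grown m 1 {#} n G" and k: "k \<in> {1..n}" and d: "deg G k \<le> j"
  shows "\<bar>expect (indep_rule m \<alpha> (Suc n) G) (\<lambda>ws. count (mset ws) k) - attach_rate m \<alpha> (deg G k) / n\<bar>
      \<le> (real j + (m * (1 + real j))\<^sup>2) / (real n)\<^sup>2"
    and "expect (indep_rule m \<alpha> (Suc n) G) (\<lambda>ws. real (count (mset ws) k) * (real (count (mset ws) k) - 1))
      \<le> (real j + (m * (1 + real j))\<^sup>2) / (real n)\<^sup>2"
proof -
  define p where "p = pick \<alpha> (Suc n) (endpoints G)"
  have sz: "size (endpoints G) = 2 * m * (n - 1)" using G by (simp add: grown_def size_endpoints)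
  then have ne: "endpoints G \<noteq> {#}" using m n by auto
  have fin: "finite (set_pmf p)"
    unfolding p_def by (rule finite_subset[OF set_pick[of n]])
      (use n ne G in \<open>auto simp: grown_def dest: set_endpoints\<close>)
  have rule: "indep_rule m \<alpha> (Suc n) G = replicate_pmf m p"
    using n by (simp add: indep_rule_def p_def)
  let ?d = "real (deg G k)"
  have pk: "pmf p k = \<alpha> / n + (1 - \<alpha>) * ?d / (2 * real m * (real n - 1))"
    unfolding p_def using n ne k \<alpha> by (subst pmf_pick) (auto simp: sz deg_def of_nat_diff)
  have n1: "real n - 1 \<ge> real n / 2" "real n - 1 > 0" using n by auto
  have frac: "(1 - \<alpha>) * ?d / (2 * (real n - 1)) \<le> j / n"
  proof -
    have "(1 - \<alpha>) * ?d \<le> 1 * real j" using \<alpha> d by (intro mult_mono) auto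
    then have "(1 - \<alpha>) * ?d / (2 * (real n - 1)) \<le> real j / n" using n1 n by (intro frac_le) auto
    then show ?thesis by simp
  qed
  have "m * pmf p k - attach_rate m \<alpha> (deg G k) / n = (1 - \<alpha>) * ?d / (2 * (real n - 1)) * (1 / n)"
    using m n n1 by (simp add: pk attach_rate_def field_simps)
  moreover have "(1 - \<alpha>) * ?d / (2 * (real n - 1)) * (1 / n) \<le> j / n * (1 / n)"
    using frac by (intro mult_right_mono) auto
  moreover have "(1 - \<alpha>) * ?d / (2 * (real n - 1)) * (1 / n) \<ge> 0" using \<alpha> n1 by simp
  moreover have "j / n * (1 / n) \<le> (real j + (m * (1 + real j))\<^sup>2) / (real n)\<^sup>2"
    by (simp add: power2_eq_square divide_right_mono)
  ultimately show "\<bar>expect (indep_rule m \<alpha> (Suc n) G) (\<lambda>ws. count (mset ws) k) - attach_rate m \<alpha> (deg G k) / n\<bar>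
      \<le> (real j + (m * (1 + real j))\<^sup>2) / (real n)\<^sup>2"
    unfolding rule expect_replicate_count_1[OF fin] by linarith
  have "(1 - \<alpha>) * ?d / (2 * real m * (real n - 1)) \<le> (1 - \<alpha>) * ?d / (2 * (real n - 1))"
  proof (rule divide_left_mono)
    have "1 * (2 * (real n - 1)) \<le> m * (2 * (real n - 1))"
      using m n1 by (intro mult_right_mono) auto
    then show "2 * (real n - 1) \<le> 2 * real m * (real n - 1)" by (simp only: of_nat_mult of_nat_numeral mult_1 mult.assoc mult.left_commute)
  qed (use m n1 \<alpha> in auto)
  moreover have "\<alpha> / n \<le> 1 / n" using \<alpha> by (intro divide_right_mono) auto
  ultimately have "pmf p k \<le> (1 + real j) / n"
    unfolding pk add_divide_distrib using frac by linarith
  then have "real m * pmf p k \<le> m * ((1 + real j) / n)" by (intro mult_left_mono) auto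
  then have "(real m * pmf p k)\<^sup>2 \<le> (m * ((1 + real j) / n))\<^sup>2" by (intro power_mono) auto
  moreover have "m * real (m - 1) * (pmf p k)\<^sup>2 \<le> m * real m * (pmf p k)\<^sup>2"
    by (intro mult_right_mono mult_left_mono) auto
  moreover have "(m * ((1 + real j) / n))\<^sup>2 \<le> (real j + (m * (1 + real j))\<^sup>2) / (real n)\<^sup>2"
    by (simp add: power_divide power_mult_distrib divide_right_mono)
  ultimately show "expect (indep_rule m \<alpha> (Suc n) G) (\<lambda>ws. real (count (mset ws) k) * (real (count (mset ws) k) - 1))
      \<le> (real j + (m * (1 + real j))\<^sup>2) / (real n)\<^sup>2"
    unfolding rule expect_replicate_count_2[OF fin] power_mult_distrib[of "real m"] power2_eq_square[of "real m"]
    by linarith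
qed

section \<open>Sequential choices\<close>

lemma seq_prob_bounds:
  fixes \<alpha> :: real
  assumes "m \<ge> 1" "0 \<le> \<alpha>" "\<alpha> < 1" "n \<ge> 2"
  shows "0 \<le> seq_prob m \<alpha> (Suc n) i" "seq_prob m \<alpha> (Suc n) i \<le> 1"
proof -
  let ?D = "2 * real m * (real n - 1) + 2 * real m * \<alpha> + (1 - \<alpha>) * real i"
  have D: "?D > 0" using assms by (intro add_pos_nonneg mult_pos_pos) auto
  have eq: "seq_prob m \<alpha> (Suc n) i = 2 * real m * \<alpha> * n / ?D" by (simp add: seq_prob_def mult_ac)
  show "0 \<le> seq_prob m \<alpha> (Suc n) i" unfolding eq using D assms by simp
  have "0 \<le> (1 - \<alpha>) * (2 * real m * (real n - 1) + i)" using assms by (intro mult_nonneg_nonneg) auto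
  then show "seq_prob m \<alpha> (Suc n) i \<le> 1" unfolding eq using D by (simp add: algebra_simps)
qed

text \<open>
  The mixing probability of the sequential rule is designed so that the size of the current multiset
  of endpoints cancels: what remains is an affine function of the current degree.
\<close>

lemma pmf_seq_pick:
  fixes \<alpha> :: real
  assumes "m \<ge> 1" "0 \<le> \<alpha>" "\<alpha> < 1" and n: "n \<ge> 2" and E: "size E = 2 * m * (n - 1) + i" and k: "k \<in> {1..n}"
  shows "pmf (pick (seq_prob m \<alpha> (Suc n) i) (Suc n) E) k
    = (2 * real m * \<alpha> + (1 - \<alpha>) * count E k) / (2 * real m * (real n - 1) + 2 * real m * \<alpha> + (1 - \<alpha>) * i)"
proof -
  define q where "q = seq_prob m \<alpha> (Suc n) i"
  define Z where "Z = 2 * real m * (real n - 1) + i"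
  define D where "D = 2 * real m * (real n - 1) + 2 * real m * \<alpha> + (1 - \<alpha>) * i"
  have D: "D > 0" unfolding D_def using assms by (intro add_pos_nonneg mult_pos_pos) auto
  have Z: "Z > 0" unfolding Z_def using assms by (intro add_pos_nonneg mult_pos_pos) auto
  have sz: "real (size E) = Z" using n by (simp add: E Z_def of_nat_diff)
  have q: "q = 2 * real m * \<alpha> * n / D" by (simp add: q_def D_def seq_prob_def mult_ac)
  have q': "1 - q = (1 - \<alpha>) * Z / D"
    using D by (simp add: q field_simps) (simp add: D_def Z_def algebra_simps)
  have "pmf (pick q (Suc n) E) k = q / n + (1 - q) * count E k / Z"
    using pmf_pick[of q n E k] seq_prob_bounds[OF assms(1-4), of i] n k sz Z
    by (cases "E = {#}") (auto simp: q_def)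
  also have "q / n = 2 * real m * \<alpha> / D" using n by (simp add: q)
  also have "(1 - q) * count E k / Z = (1 - \<alpha>) * count E k / D" using Z by (simp add: q')
  finally show ?thesis by (simp add: q_def D_def add_divide_distrib)
qed

lemma set_seq_choices:
  assumes n: "n > 0" and G: "set_mset G \<subseteq> {1..n} \<times> {1..n}" "G \<noteq> {#}" and ws: "ws \<in> set_pmf (seq_choices m \<alpha> (Suc n) G i)"
  shows "length ws = i \<and> set ws \<subseteq> {1..n}"
  using ws
proof (induction i arbitrary: ws)
  case (Suc i)
  then obtain us w where us: "us \<in> set_pmf (seq_choices m \<alpha> (Suc n) G i)"
    and w: "w \<in> set_pmf (pick (seq_prob m \<alpha> (Suc n) i) (Suc n) (endpoints G + mset us))" and ws: "ws = us @ [w]"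
    by auto
  have "size (endpoints G) > 0" using G(2) by (simp add: size_endpoints nonempty_has_size)
  then have "endpoints G + mset us \<noteq> {#}" by auto
  moreover have "set_mset (endpoints G + mset us) \<subseteq> {1..n}"
    using set_endpoints[OF G(1)] Suc.IH[OF us] by simp
  ultimately have "w \<in> {1..n}"
    using set_pick[OF n] w by blast
  then show ?case using Suc.IH[OF us] ws by auto
qed simp

lemma attachment_process_seq:
  assumes m: "m \<ge> 1"
  shows "attachment_process m 1 {#} (seq_rule m \<alpha>)"
proof (rule attachment_processI)
  fix n G ws
  assume n: "n \<ge> 1" and G: "grown m 1 {#} n G" and ws: "ws \<in> set_pmf (seq_rule m \<alpha> (Suc n) G)"
  show "length ws = m \<and> set ws \<subseteq> {1..n}"
  proof (cases "n = 1")
    case True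
    then show ?thesis using ws by (auto simp: seq_rule_def)
  next
    case False
    then have "size G > 0" using G m n by (simp add: grown_def)
    then have "G \<noteq> {#}" by auto
    then show ?thesis using ws False n G by (intro set_seq_choices) (auto simp: seq_rule_def grown_def)
  qed
qed (use m in auto)

text \<open>
  Here \<open>K / n\<close> bounds the probability of a single hit, \<open>m * K + 2 * (2 * m + j)\<close> the error made in
  the mean by a single edge, and \<open>2 * m * K\<^sup>2\<close> the growth of the factorial moment by a single
  edge (the latter two in units of \<open>1 / n\<^sup>2\<close>).
\<close>

definition seq_error :: "nat \<Rightarrow> nat \<Rightarrow> real" where
  "seq_error m j = (let K = 3 * real m + j in m * (m * K + 2 * (2 * real m + j) + 2 * m * K\<^sup>2))"

text \<open>
  Along the \<open>m\<close> successive choices, \<open>step\<close> below gives the evolution of every moment of the number of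
  hits. The feedback of earlier hits on later ones has size \<open>O(1 / n)\<close> times the number of hits,
  which itself has mean \<open>O(1 / n)\<close>.
\<close>

lemma rate_seq:
  fixes j m n :: nat and \<alpha> :: real
  assumes m: "m \<ge> 1" and \<alpha>: "0 \<le> \<alpha>" "\<alpha> < 1" and n: "n \<ge> 2"
    and G: "grown m 1 {#} n G" and k: "k \<in> {1..n}" and d: "deg G k \<le> j"
  shows "\<bar>expect (seq_rule m \<alpha> (Suc n) G) (\<lambda>ws. count (mset ws) k) - attach_rate m \<alpha> (deg G k) / n\<bar>
      \<le> seq_error m j / (real n)\<^sup>2"
    and "expect (seq_rule m \<alpha> (Suc n) G) (\<lambda>ws. real (count (mset ws) k) * (real (count (mset ws) k) - 1))
      \<le> seq_error m j / (real n)\<^sup>2"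
proof -
  define K1 where "K1 = 3 * real m + j"
  define K2 where "K2 = m * K1 + 2 * (2 * real m + j)"
  define K3 where "K3 = 2 * m * K1\<^sup>2"
  have err: "seq_error m j = m * (K2 + K3)"
    by (simp add: seq_error_def Let_def K1_def K2_def K3_def)
  have rule: "seq_rule m \<alpha> (Suc n) G = seq_choices m \<alpha> (Suc n) G m"
    using n by (simp add: seq_rule_def)
  have sub: "set_mset G \<subseteq> {1..n} \<times> {1..n}" and sz: "size G = m * (n - 1)" using G by (auto simp: grown_def)
  have ne: "G \<noteq> {#}" using sz m n by auto
  let ?S = "seq_choices m \<alpha> (Suc n) G"
  let ?X = "\<lambda>ws. real (count (mset ws) k)"
  let ?d = "real (deg G k)"
  define D where "D i = 2 * real m * (real n - 1) + 2 * real m * \<alpha> + (1 - \<alpha>) * i" for i :: nat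
  define \<pi> where "\<pi> i x = (2 * real m * \<alpha> + (1 - \<alpha>) * (?d + x)) / D i" for i and x :: real
  define base where "base = (2 * real m * \<alpha> + (1 - \<alpha>) * ?d) / (2 * real m * real n)"
  have supp: "length ws = i \<and> set ws \<subseteq> {1..n}" if "ws \<in> set_pmf (?S i)" for ws i
    using set_seq_choices[OF _ sub ne that] n by simp
  have fin: "finite (set_pmf (?S i))" for i
    by (rule finite_subset[OF _ finite_lists_length_eq[of "{1..n}" i]]) (use supp in auto)
  have step: "expect (?S (Suc i)) (\<lambda>ws. f (?X ws)) = expect (?S i) (\<lambda>ws. f (?X ws) + \<pi> i (?X ws) * (f (?X ws + 1) - f (?X ws)))" for i f
  proof -
    let ?p = "\<lambda>ws. pick (seq_prob m \<alpha> (Suc n) i) (Suc n) (endpoints G + mset ws)"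
    have finp: "finite (set_pmf (?p ws))" if "ws \<in> set_pmf (?S i)" for ws
      by (rule finite_subset[OF set_pick[of n]])
        (use n ne supp[OF that] set_endpoints[OF sub] in \<open>auto simp: endpoints_def\<close>)
    have "expect (?S (Suc i)) (\<lambda>ws. f (?X ws)) = expect (?S i) (\<lambda>ws. expect (?p ws) (\<lambda>w. f (?X (ws @ [w]))))"
      by (simp add: expect_bind fin finp integral_map_pmf)
    also have "\<dots> = expect (?S i) (\<lambda>ws. f (?X ws) + \<pi> i (?X ws) * (f (?X ws + 1) - f (?X ws)))"
    proof (rule expect_cong)
      fix ws assume ws: "ws \<in> set_pmf (?S i)"
      have "expect (?p ws) (\<lambda>w. f (?X (ws @ [w])))
          = expect (?p ws) (\<lambda>w. f (?X ws) + of_bool (w = k) * (f (?X ws + 1) - f (?X ws)))"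
        by (rule expect_cong) (auto simp: add.commute)
      also have "\<dots> = f (?X ws) + pmf (?p ws) k * (f (?X ws + 1) - f (?X ws))"
        by (simp only: expect_add[OF finp[OF ws]] expect_of_bool_eq) simp
      also have "pmf (?p ws) k = \<pi> i (?X ws)"
        using pmf_seq_pick[OF m \<alpha> n _ k, of "endpoints G + mset ws" i] supp[OF ws]
        by (simp add: size_endpoints sz \<pi>_def D_def deg_def)
      finally show "expect (?p ws) (\<lambda>w. f (?X (ws @ [w]))) = f (?X ws) + \<pi> i (?X ws) * (f (?X ws + 1) - f (?X ws))" .
    qed
    finally show ?thesis .
  qed
  have D_ge: "D i \<ge> real m * real n" for i
  proof -
    have "real m * n \<le> 2 * real m * (real n - 1)" using n m by (simp add: algebra_simps)
    also have "\<dots> \<le> D i" unfolding D_def using \<alpha> by simp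
    finally show ?thesis .
  qed
  have mn: "real m * n > 0" using m n by simp
  have n_le: "real n \<le> real m * real n" using m mult_right_mono[of 1 "real m" "real n"] by simp
  have D_diff: "\<bar>2 * real m * real n - D i\<bar> \<le> 3 * real m" if "i \<le> m" for i
  proof -
    have "2 * real m * real n - D i = (1 - \<alpha>) * (2 * real m - real i)" by (simp add: D_def algebra_simps)
    moreover have "0 \<le> (1 - \<alpha>) * (2 * real m - real i)" using \<alpha> that by (intro mult_nonneg_nonneg) auto
    moreover have "(1 - \<alpha>) * (2 * real m - real i) \<le> 1 * (3 * real m)" using \<alpha> that by (intro mult_mono) auto
    ultimately show ?thesis by simp
  qed
  have num: "0 \<le> 2 * real m * \<alpha> + (1 - \<alpha>) * (?d + x)" "2 * real m * \<alpha> + (1 - \<alpha>) * (?d + x) \<le> 2 * real m + real j + x" if "x \<ge> 0" for x :: real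
  proof -
    show "0 \<le> 2 * real m * \<alpha> + (1 - \<alpha>) * (?d + x)" using \<alpha> that by simp
    have "2 * real m * \<alpha> \<le> 2 * real m * 1" using \<alpha> by (intro mult_left_mono) auto
    moreover have "(1 - \<alpha>) * (?d + x) \<le> 1 * (real j + x)" using \<alpha> d that by (intro mult_mono) auto
    ultimately show "2 * real m * \<alpha> + (1 - \<alpha>) * (?d + x) \<le> 2 * real m + real j + x" by simp
  qed
  have \<pi>_bounds: "0 \<le> \<pi> i x" "\<pi> i x \<le> K1 / n" if "0 \<le> x" "x \<le> m" for i and x :: real
  proof -
    have D: "D i \<ge> n" "D i > 0" using D_ge[of i] n_le mn by linarith+
    show "0 \<le> \<pi> i x" unfolding \<pi>_def using num(1)[OF that(1)] D(2) by simp
    show "\<pi> i x \<le> K1 / n"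
      unfolding \<pi>_def using num[OF that(1)] D that n by (intro frac_le) (auto simp: K1_def)
  qed
  have \<pi>_base: "\<bar>\<pi> i x - base\<bar> \<le> x / n + 2 * (2 * real m + j) / (real n)\<^sup>2" if "0 \<le> x" "i \<le> m" for i and x :: real
  proof -
    have D: "D i \<ge> n" "D i > 0" using D_ge[of i] n_le mn by linarith+
    define A where "A = 2 * real m * \<alpha> + (1 - \<alpha>) * ?d"
    have A: "0 \<le> A" "A \<le> 2 * real m + real j" using num[of 0] by (auto simp: A_def)
    have "\<pi> i x - base = (1 - \<alpha>) * x / D i + (A / D i - A / (2 * real m * real n))"
    proof -
      have "2 * real m * \<alpha> + (1 - \<alpha>) * (?d + x) = (1 - \<alpha>) * x + A" by (simp add: A_def algebra_simps)
      then show ?thesis by (simp only: \<pi>_def base_def A_def[symmetric] add_divide_distrib[of _ A])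
    qed
    moreover have "A / D i - A / (2 * real m * real n) = A * (2 * real m * real n - D i) / (D i * (2 * real m * real n))"
      using D(2) m n by (simp add: field_simps)
    moreover have "\<bar>A * (2 * real m * real n - D i) / (D i * (2 * real m * real n))\<bar> \<le> (2 * real m + real j) * (3 * real m) / (real m * real n * (2 * real m * real n))"
    proof -
      have "\<bar>A * (2 * real m * real n - D i)\<bar> \<le> (2 * real m + real j) * (3 * real m)"
        unfolding abs_mult using A D_diff[OF that(2)] by (intro mult_mono) auto
      moreover have "real m * real n * (2 * real m * real n) \<le> D i * (2 * real m * real n)" using D_ge by (intro mult_right_mono) auto
      moreover have "\<bar>D i * (2 * real m * real n)\<bar> = D i * (2 * real m * real n)" using D by simp
      ultimately show ?thesis unfolding abs_divide using mn by (simp only:) (intro frac_le, auto)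
    qed
    moreover have "(2 * real m + real j) * (3 * real m) / (real m * real n * (2 * real m * real n)) \<le> 2 * (2 * real m + j) / (real n)\<^sup>2"
    proof -
      have "(2 * real m + real j) * (3 * real m) / (real m * real n * (2 * real m * real n)) = (3 / 2) * (2 * real m + real j) / (m * (real n)\<^sup>2)"
        using m n by (simp add: field_simps power2_eq_square)
      also have "\<dots> \<le> 2 * (2 * real m + j) / (real n)\<^sup>2"
        using m n by (intro frac_le mult_right_mono) auto
      finally show ?thesis .
    qed
    moreover have "(1 - \<alpha>) * x / D i \<le> x / n"
      using D \<alpha> that n mult_right_mono[of "1 - \<alpha>" 1 x] by (intro frac_le) auto
    moreover have "(1 - \<alpha>) * x / D i \<ge> 0" using D \<alpha> that by simp
    ultimately show ?thesis by linarith
  qed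
  define a where "a i = expect (?S i) ?X" for i
  define b where "b i = expect (?S i) (\<lambda>ws. ?X ws * (?X ws - 1))" for i
  have X_le: "?X ws \<le> m" if "ws \<in> set_pmf (?S i)" "i \<le> m" for ws i
    using supp[OF that(1)] that(2) count_le_size[of "mset ws" k] by simp
  have a_Suc: "a (Suc i) = a i + expect (?S i) (\<lambda>ws. \<pi> i (?X ws))" for i
    using step[of i "\<lambda>x. x"] by (simp add: a_def expect_add fin)
  have b_Suc: "b (Suc i) = b i + expect (?S i) (\<lambda>ws. \<pi> i (?X ws) * (2 * ?X ws))" for i
  proof -
    have "b (Suc i) = expect (?S i) (\<lambda>ws. ?X ws * (?X ws - 1) + \<pi> i (?X ws) * (2 * ?X ws))"
      unfolding b_def step[of i "\<lambda>x. x * (x - 1)"] by (intro expect_cong) (simp add: algebra_simps)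
    then show ?thesis by (simp only: b_def expect_add[OF fin])
  qed
  have main: "0 \<le> a i \<and> a i \<le> i * (K1 / n) \<and> \<bar>a i - i * base\<bar> \<le> i * (K2 / (real n)\<^sup>2) \<and> b i \<le> i * (K3 / (real n)\<^sup>2)"
    if "i \<le> m" for i
    using that
  proof (induction i)
    case 0
    then show ?case by (simp add: a_def b_def)
  next
    case (Suc i)
    then have i: "i \<le> m" and IH: "0 \<le> a i" "a i \<le> i * (K1 / n)" "\<bar>a i - i * base\<bar> \<le> i * (K2 / (real n)\<^sup>2)"
      "b i \<le> i * (K3 / (real n)\<^sup>2)" by auto
    have K1: "K1 \<ge> 0" by (simp add: K1_def)
    have "real i * (K1 / n) \<le> m * (K1 / n)" using i K1 by (intro mult_right_mono) auto
    with IH(2) have a_le: "a i \<le> m * (K1 / n)" by linarith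
    have "expect (?S i) (\<lambda>ws. \<pi> i (?X ws)) \<ge> 0"
      using X_le[OF _ i] by (intro expect_nonneg \<pi>_bounds) auto
    moreover have "expect (?S i) (\<lambda>ws. \<pi> i (?X ws)) \<le> K1 / n"
      using X_le[OF _ i] by (intro expect_le_const[OF fin] \<pi>_bounds) auto
    moreover have "\<bar>expect (?S i) (\<lambda>ws. \<pi> i (?X ws)) - base\<bar> \<le> K2 / (real n)\<^sup>2"
    proof -
      have "\<bar>expect (?S i) (\<lambda>ws. \<pi> i (?X ws)) - expect (?S i) (\<lambda>_. base)\<bar>
          \<le> expect (?S i) (\<lambda>ws. ?X ws / n + 2 * (2 * real m + j) / (real n)\<^sup>2)"
        using \<pi>_base[OF _ i] by (intro expect_abs_diff_le fin) auto
      also have "\<dots> = a i / n + 2 * (2 * real m + j) / (real n)\<^sup>2"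
        by (simp add: expect_add fin a_def)
      also have "a i / n \<le> m * (K1 / n) / n" using a_le by (intro divide_right_mono) auto
      also have "m * (K1 / n) / n + 2 * (2 * real m + j) / (real n)\<^sup>2 = K2 / (real n)\<^sup>2"
        by (simp add: K2_def power2_eq_square add_divide_distrib)
      finally show ?thesis by simp
    qed
    moreover have "expect (?S i) (\<lambda>ws. \<pi> i (?X ws) * (2 * ?X ws)) \<le> K3 / (real n)\<^sup>2"
    proof -
      have "expect (?S i) (\<lambda>ws. \<pi> i (?X ws) * (2 * ?X ws)) \<le> expect (?S i) (\<lambda>ws. K1 / n * (2 * ?X ws))"
        using X_le[OF _ i] by (intro expect_mono fin mult_right_mono \<pi>_bounds) auto
      also have "\<dots> = 2 * (K1 / n) * a i" by (simp add: a_def)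
      also have "\<dots> \<le> 2 * (K1 / n) * (m * (K1 / n))" using a_le K1 by (intro mult_left_mono) auto
      also have "\<dots> = K3 / (real n)\<^sup>2" by (simp add: K3_def power2_eq_square)
      finally show ?thesis .
    qed
    ultimately show ?case
      using IH unfolding a_Suc b_Suc of_nat_Suc distrib_right abs_le_iff by auto
  qed
  have K: "K2 \<ge> 0" "K3 \<ge> 0" by (auto simp: K2_def K3_def K1_def)
  have base: "m * base = attach_rate m \<alpha> (deg G k) / n"
    using m n by (simp add: base_def attach_rate_def field_simps)
  have "real m * (K2 / (real n)\<^sup>2) \<le> m * (K2 + K3) / (real n)\<^sup>2"
    "real m * (K3 / (real n)\<^sup>2) \<le> m * (K2 + K3) / (real n)\<^sup>2"
    using K by (simp_all add: divide_right_mono mult_left_mono)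
  then show "\<bar>expect (seq_rule m \<alpha> (Suc n) G) (\<lambda>ws. count (mset ws) k) - attach_rate m \<alpha> (deg G k) / n\<bar>
      \<le> seq_error m j / (real n)\<^sup>2"
    and "expect (seq_rule m \<alpha> (Suc n) G) (\<lambda>ws. real (count (mset ws) k) * (real (count (mset ws) k) - 1))
      \<le> seq_error m j / (real n)\<^sup>2"
    using main[of m] unfolding err rule base a_def b_def by linarith+
qed

section \<open>Choices conditioned on being distinct\<close>

lemma expect_swap:
  assumes "finite (set_pmf p)" "finite (set_pmf q)"
  shows "expect p (\<lambda>x. expect q (\<lambda>y. f x y)) = expect q (\<lambda>y. expect p (\<lambda>x. f x y))"
proof -
  have "expect p (\<lambda>x. expect q (\<lambda>y. f x y)) = (\<Sum>x\<in>set_pmf p. \<Sum>y\<in>set_pmf q. f x y * pmf q y * pmf p x)"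
    using assms by (simp add: integral_measure_pmf_real[of "set_pmf p"] integral_measure_pmf_real[of "set_pmf q"] sum_distrib_right)
  also have "\<dots> = (\<Sum>y\<in>set_pmf q. \<Sum>x\<in>set_pmf p. f x y * pmf q y * pmf p x)"
    by (rule sum.swap)
  also have "\<dots> = expect q (\<lambda>y. expect p (\<lambda>x. f x y))"
    using assms by (simp add: integral_measure_pmf_real[of "set_pmf p"] integral_measure_pmf_real[of "set_pmf q"] sum_distrib_left sum_distrib_right mult_ac)
  finally show ?thesis .
qed

lemma expect_cond_pmf:
  assumes fin: "finite (set_pmf p)" and ne: "set_pmf p \<inter> A \<noteq> {}"
  shows "expect (cond_pmf p A) f = expect p (\<lambda>x. f x * of_bool (x \<in> A)) / expect p (\<lambda>x. of_bool (x \<in> A))"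
proof -
  have "measure p A = expect p (indicator A)" by simp
  also have "\<dots> = expect p (\<lambda>x. of_bool (x \<in> A))"
    by (intro expect_cong) (simp add: indicator_def of_bool_def)
  finally have A: "measure p A = \<dots>" .
  have "expect (cond_pmf p A) f = (\<Sum>x\<in>set_pmf p. f x * pmf (cond_pmf p A) x)"
    using fin ne by (intro integral_measure_pmf_real) auto
  also have "\<dots> = (\<Sum>x\<in>set_pmf p. f x * of_bool (x \<in> A) * pmf p x) / measure p A"
    unfolding sum_divide_distrib by (intro sum.cong) (auto simp: pmf_cond[OF ne])
  also have "(\<Sum>x\<in>set_pmf p. f x * of_bool (x \<in> A) * pmf p x) = expect p (\<lambda>x. f x * of_bool (x \<in> A))"
    using fin by (intro integral_measure_pmf_real[symmetric]) auto
  finally show ?thesis unfolding A .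
qed

lemma distinct_iff_count_le_1: "distinct ws \<longleftrightarrow> (\<forall>a. count (mset ws) a \<le> 1)"
proof
  assume *: "\<forall>a. count (mset ws) a \<le> 1"
  have "count (mset ws) a = (if a \<in> set ws then 1 else 0)" for a
    using *[rule_format, of a] by (auto simp: count_eq_zero_iff le_Suc_eq)
  then show "distinct ws" by (simp add: distinct_count_atmost_1)
qed (simp add: distinct_count_atmost_1)

lemma distinct_count_le_1: "distinct ws \<Longrightarrow> count (mset ws) a \<le> 1"
  unfolding distinct_iff_count_le_1 by blast

definition prob_distinct :: "nat \<Rightarrow> 'a pmf \<Rightarrow> real" where
  "prob_distinct n p = expect (replicate_pmf n p) (\<lambda>ws. of_bool (distinct ws))"

context
  fixes p :: "'a pmf" and q :: real
  assumes fin: "finite (set_pmf p)" and q: "\<And>k. pmf p k \<le> q"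
begin

lemma max_prob_nonneg: "0 \<le> q"
  using q[of undefined] pmf_nonneg[of p undefined] by linarith

text \<open>
  Given \<open>n\<close> distinct draws, the next one repeats one of them with probability at most \<open>n * q\<close>.
\<close>

lemma prob_distinct_Suc_ge: "prob_distinct (Suc n) p \<ge> prob_distinct n p * (1 - n * q)"
proof -
  note [simp] = finite_replicate_pmf[OF fin] fin
  have "prob_distinct n p * (1 - n * q) = expect (replicate_pmf n p) (\<lambda>ws. of_bool (distinct ws) * (1 - n * q))"
    by (simp add: prob_distinct_def)
  also have "\<dots> \<le> expect (replicate_pmf n p) (\<lambda>ws. expect p (\<lambda>w. of_bool (distinct (w # ws))))"
  proof (rule expect_mono)
    fix ws assume "ws \<in> set_pmf (replicate_pmf n p)"
    then have len: "length ws = n" by (simp add: set_replicate_pmf)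
    have "expect p (\<lambda>w. of_bool (w \<in> set ws)) = (\<Sum>w\<in>set ws. of_bool (w \<in> set ws) * pmf p w)"
      by (rule integral_measure_pmf_real) auto
    also have "\<dots> = (\<Sum>w\<in>set ws. pmf p w)" by (intro sum.cong) auto
    also have "\<dots> \<le> card (set ws) * q" using sum_bounded_above[of "set ws" "pmf p" q] q by simp
    also have "\<dots> \<le> n * q" using card_length[of ws] len max_prob_nonneg by (intro mult_right_mono) auto
    finally have le: "expect p (\<lambda>w. of_bool (w \<in> set ws)) \<le> n * q" .
    have "expect p (\<lambda>w. of_bool (distinct (w # ws)))
        = expect p (\<lambda>w. of_bool (distinct ws) * (1 - of_bool (w \<in> set ws)))"
      by (intro expect_cong) auto
    also have "\<dots> = of_bool (distinct ws) * (1 - expect p (\<lambda>w. of_bool (w \<in> set ws)))"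
      by (simp add: expect_diff)
    finally show "of_bool (distinct ws) * (1 - n * q) \<le> expect p (\<lambda>w. of_bool (distinct (w # ws)))"
      using le by (auto intro: mult_left_mono)
  qed simp
  also have "\<dots> = prob_distinct (Suc n) p"
    unfolding prob_distinct_def expect_replicate_Suc[OF fin] by (rule expect_swap) auto
  finally show ?thesis .
qed

lemma prob_distinct_bounds: "0 \<le> prob_distinct n p" "prob_distinct n p \<le> 1"
  unfolding prob_distinct_def
  by (auto intro!: expect_nonneg expect_le_const finite_replicate_pmf fin)

lemma prob_distinct_ge: "prob_distinct n p \<ge> 1 - (real n)\<^sup>2 * q"
proof (induction n)
  case (Suc n)
  have "prob_distinct n p * (n * q) \<le> 1 * (n * q)"
    using prob_distinct_bounds max_prob_nonneg by (intro mult_right_mono) auto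
  with Suc prob_distinct_Suc_ge[of n] have "prob_distinct (Suc n) p \<ge> 1 - (real n)\<^sup>2 * q - n * q"
    by (simp add: algebra_simps)
  moreover have "(real (Suc n))\<^sup>2 * q \<ge> (real n)\<^sup>2 * q + n * q"
    using max_prob_nonneg by (simp add: power2_eq_square algebra_simps)
  ultimately show ?case by linarith
qed (simp add: prob_distinct_def)

text \<open>
  Unlike the linear bound, this one is of use even when \<open>q\<close> is not small.
\<close>

lemma prob_distinct_half_power:
  assumes "real n * q \<le> 1 / 2"
  shows "prob_distinct n p \<ge> (1 / 2) ^ n"
  using assms
proof (induction n)
  case (Suc n)
  have nq: "real n * q \<le> 1 / 2" using Suc.prems max_prob_nonneg by (simp add: algebra_simps)
  have "(1 / 2) ^ n * (1 / 2) \<le> prob_distinct n p * (1 - n * q)"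
    using Suc.IH[OF nq] nq prob_distinct_bounds by (intro mult_mono) auto
  then show ?case using prob_distinct_Suc_ge[of n] by simp
qed (simp add: prob_distinct_def)

definition prob_distinct_with :: "nat \<Rightarrow> 'a \<Rightarrow> real" where
  "prob_distinct_with n k = expect (replicate_pmf n p) (\<lambda>ws. of_bool (distinct (k # ws)))"

lemma prob_distinct_with_bounds:
  "prob_distinct_with n k \<le> prob_distinct n p" "0 \<le> prob_distinct_with n k"
  "prob_distinct_with n k \<ge> prob_distinct n p - n * pmf p k"
proof -
  note [simp] = finite_replicate_pmf[OF fin]
  show "prob_distinct_with n k \<le> prob_distinct n p"
    unfolding prob_distinct_with_def prob_distinct_def by (intro expect_mono) auto
  show "0 \<le> prob_distinct_with n k"
    unfolding prob_distinct_with_def by (intro expect_nonneg) auto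
  have "prob_distinct n p \<le> expect (replicate_pmf n p) (\<lambda>ws. of_bool (distinct (k # ws)) + real (count (mset ws) k))"
    unfolding prob_distinct_def
  proof (intro expect_mono)
    fix ws :: "'a list"
    have "k \<in> set ws \<Longrightarrow> count (mset ws) k \<ge> 1" by (simp add: Suc_le_eq)
    then show "of_bool (distinct ws) \<le> of_bool (distinct (k # ws)) + real (count (mset ws) k)"
      by (cases "k \<in> set ws") auto
  qed simp
  also have "\<dots> = prob_distinct_with n k + n * pmf p k"
    by (simp add: expect_add prob_distinct_with_def expect_replicate_count_1[OF fin])
  finally show "prob_distinct_with n k \<ge> prob_distinct n p - n * pmf p k" by simp
qed

text \<open>
  The probability that \<open>k\<close> is drawn and all draws are distinct factorises by exchangeability.
\<close>

lemma expect_cond_distinct_count: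
  assumes ne: "set_pmf (replicate_pmf n p) \<inter> {ws. distinct ws} \<noteq> {}"
  shows "expect (cond_pmf (replicate_pmf n p) {ws. distinct ws}) (\<lambda>ws. real (count (mset ws) k))
    = n * pmf p k * prob_distinct_with (n - 1) k / prob_distinct n p"
proof -
  have "expect (replicate_pmf n p) (\<lambda>ws. real (count (mset ws) k) * of_bool (distinct ws))
      = n * pmf p k * prob_distinct_with (n - 1) k"
    using expect_replicate_count[OF fin, of n k "\<lambda>M. of_bool (\<forall>a. count M a \<le> 1)"]
    unfolding prob_distinct_with_def distinct_iff_count_le_1 mset.simps .
  then show ?thesis
    using expect_cond_pmf[OF finite_replicate_pmf[OF fin] ne, of "\<lambda>ws. real (count (mset ws) k)"]
    by (simp add: prob_distinct_def)
qed

text \<open>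
  Both probabilities in the quotient differ from \<open>1\<close> by at most \<open>m\<^sup>2 * q\<close>, so conditioning changes
  the mean by a factor close to \<open>1\<close> when \<open>q\<close> is small.
\<close>

lemma cond_distinct_count_approx:
  assumes ne: "set_pmf (replicate_pmf m p) \<inter> {ws. distinct ws} \<noteq> {}"
    and m: "m \<ge> 1" and pos: "prob_distinct m p \<ge> \<delta>" "\<delta> > 0"
  shows "\<bar>expect (cond_pmf (replicate_pmf m p) {ws. distinct ws}) (\<lambda>ws. real (count (mset ws) k)) - m * pmf p k\<bar>
    \<le> m * pmf p k * ((real m)\<^sup>2 * q / \<delta>)"
proof -
  let ?D = "prob_distinct m p" and ?F = "prob_distinct_with (m - 1) k"
  have D: "?D > 0" using pos by linarith
  have "real (m - 1) * pmf p k \<le> real (m - 1) * q" using q by (intro mult_left_mono) auto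
  then have "?F \<ge> 1 - (real (m - 1))\<^sup>2 * q - real (m - 1) * q"
    using prob_distinct_with_bounds(3)[of "m - 1" k] prob_distinct_ge[of "m - 1"] by linarith
  moreover have "(real (m - 1))\<^sup>2 * q + real (m - 1) * q \<le> (real m)\<^sup>2 * q"
  proof -
    have "(real (m - 1))\<^sup>2 + real (m - 1) \<le> (real m)\<^sup>2"
      using m by (simp add: of_nat_diff power2_eq_square algebra_simps)
    from mult_right_mono[OF this max_prob_nonneg] show ?thesis by (simp add: distrib_right)
  qed
  ultimately have F: "?F \<ge> 1 - (real m)\<^sup>2 * q" "?F \<le> 1"
    using prob_distinct_with_bounds(1)[of "m - 1" k] prob_distinct_bounds(2)[of "m - 1"] by linarith+
  have "\<bar>?F - ?D\<bar> \<le> (real m)\<^sup>2 * q"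
    using F prob_distinct_ge[of m] prob_distinct_bounds(2)[of m] by linarith
  then have "\<bar>?F / ?D - 1\<bar> \<le> (real m)\<^sup>2 * q / \<delta>"
  proof -
    have "?F / ?D - 1 = (?F - ?D) / ?D" using D by (simp add: field_simps)
    then have "\<bar>?F / ?D - 1\<bar> = \<bar>?F - ?D\<bar> / ?D"
      using D by (simp only: abs_divide abs_of_pos)
    also have "\<dots> \<le> (real m)\<^sup>2 * q / \<delta>"
      using \<open>\<bar>?F - ?D\<bar> \<le> (real m)\<^sup>2 * q\<close> pos max_prob_nonneg by (intro frac_le) auto
    finally show ?thesis .
  qed
  then have "\<bar>m * pmf p k * (?F / ?D - 1)\<bar> \<le> m * pmf p k * ((real m)\<^sup>2 * q / \<delta>)"
    unfolding abs_mult by (intro mult_mono) auto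
  then show ?thesis unfolding expect_cond_distinct_count[OF ne] by (simp add: algebra_simps)
qed

text \<open>
  A bound that does not assume \<open>q\<close> to tend to zero: conditioning can increase the mean at most by
  the factor \<open>1 / (1 - (m - 1) * q)\<close>, as in both
  probabilities of the quotient the other \<open>m - 1\<close> draws have to be distinct.
\<close>

lemma cond_distinct_count_le:
  assumes ne: "set_pmf (replicate_pmf m p) \<inter> {ws. distinct ws} \<noteq> {}"
    and m: "m \<ge> 1" and pos: "prob_distinct m p > 0" and small: "real (m - 1) * q < 1"
  shows "expect (cond_pmf (replicate_pmf m p) {ws. distinct ws}) (\<lambda>ws. real (count (mset ws) k))
    \<le> m / (1 - real (m - 1) * q) * pmf p k"
proof -
  let ?D = "prob_distinct m p" and ?F = "prob_distinct_with (m - 1) k"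
  have "?F * (1 - real (m - 1) * q) \<le> prob_distinct (m - 1) p * (1 - real (m - 1) * q)"
    using prob_distinct_with_bounds(1) small by (intro mult_right_mono) auto
  also have "\<dots> \<le> ?D" using prob_distinct_Suc_ge[of "m - 1"] m by simp
  finally have "?F / ?D \<le> 1 / (1 - real (m - 1) * q)"
    using pos small by (simp add: field_simps)
  then have "m * pmf p k * (?F / ?D) \<le> m * pmf p k * (1 / (1 - real (m - 1) * q))"
    by (intro mult_left_mono) auto
  then show ?thesis unfolding expect_cond_distinct_count[OF ne] by (simp add: mult_ac)
qed

end

section \<open>The conditional model\<close>

text \<open>
  Two further invariants of the conditional model. Once vertex \<open>m + 1\<close> has arrived, the first \<open>m\<close>
  vertices have positive degree, which makes \<open>m\<close> distinct choices possible even for \<open>\<alpha> = 0\<close>. As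
  each vertex receives at most one edge at a time, degrees grow at most by one per step.
\<close>

definition cond_state :: "nat \<Rightarrow> mgraph \<Rightarrow> nat \<Rightarrow> mgraph \<Rightarrow> bool" where
  "cond_state m H n G \<longleftrightarrow> grown m m H n G \<and> (n > m \<longrightarrow> {1..m} \<subseteq> set_mset (endpoints G))
     \<and> (\<forall>k. deg G k \<le> n + 2 * size H)"

locale conditional_model =
  fixes m :: nat and \<alpha> :: real and H :: mgraph
  assumes m: "m \<ge> 2" and \<alpha>: "0 \<le> \<alpha>" "\<alpha> < 1" and H: "set_mset H \<subseteq> {1..m} \<times> {1..m}"
begin

definition step_law :: "nat \<Rightarrow> mgraph \<Rightarrow> nat pmf" where
  "step_law n G = pick \<alpha> (Suc n) (endpoints G)"

definition degree_sum :: "nat \<Rightarrow> real" where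
  "degree_sum n = 2 * size H + 2 * m * (real n - m)"

lemma cond_rule_eq:
  "n > m \<Longrightarrow> cond_rule m \<alpha> (Suc n) G = cond_pmf (replicate_pmf m (step_law n G)) {ws. distinct ws}"
  by (simp add: cond_rule_def step_law_def)

lemma degree_sum_pos: "n > m \<Longrightarrow> degree_sum n > 0"
  using m by (auto simp: degree_sum_def intro!: add_nonneg_pos)

lemma size_endpoints_eq: "grown m m H n G \<Longrightarrow> n \<ge> m \<Longrightarrow> size (endpoints G) = degree_sum n"
  by (simp add: grown_def size_endpoints degree_sum_def of_nat_diff)

lemma endpoints_nonempty: "grown m m H n G \<Longrightarrow> n > m \<Longrightarrow> endpoints G \<noteq> {#}"
  using size_endpoints_eq[of n G] degree_sum_pos[of n] by auto

lemma pmf_step_law: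
  assumes "grown m m H n G" "n > m" "k \<in> {1..n}"
  shows "pmf (step_law n G) k = \<alpha> / n + (1 - \<alpha>) * deg G k / degree_sum n"
  using assms \<alpha> size_endpoints_eq[OF assms(1)] endpoints_nonempty[OF assms(1,2)]
  unfolding step_law_def deg_def by (subst pmf_pick) auto

lemma set_step_law:
  assumes "grown m m H n G" "n > m"
  shows "set_pmf (step_law n G) \<subseteq> {1..n}"
  unfolding step_law_def
  using assms endpoints_nonempty[OF assms] by (intro set_pick set_endpoints) (auto simp: grown_def)

lemma finite_step_law: "grown m m H n G \<Longrightarrow> n > m \<Longrightarrow> finite (set_pmf (step_law n G))"
  using set_step_law finite_subset by blast

lemma distinct_choice_possible:
  assumes G: "cond_state m H n G" and n: "n > m"
  shows "set_pmf (replicate_pmf m (step_law n G)) \<inter> {ws. distinct ws} \<noteq> {}"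
proof -
  have g: "grown m m H n G" using G by (simp add: cond_state_def)
  have "k \<in> set_pmf (step_law n G)" if k: "k \<in> {1..m}" for k
  proof -
    have "k \<in># endpoints G" using G n k by (auto simp: cond_state_def)
    then have "deg G k > 0" by (simp add: deg_def)
    then have "pmf (step_law n G) k > 0"
      using \<alpha> degree_sum_pos[OF n] k n
      by (subst pmf_step_law[OF g n]) (auto intro!: add_nonneg_pos divide_pos_pos mult_pos_pos)
    then show ?thesis by (simp add: set_pmf_iff)
  qed
  then have "[1..<m+1] \<in> set_pmf (replicate_pmf m (step_law n G))"
    by (auto simp: set_replicate_pmf)
  then show ?thesis by (auto simp del: upt_Suc)
qed

lemma cond_rule_support:
  assumes G: "cond_state m H n G" and n: "n \<ge> m" and ws: "ws \<in> set_pmf (cond_rule m \<alpha> (Suc n) G)"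
  shows "length ws = m \<and> set ws \<subseteq> {1..n} \<and> distinct ws"
proof (cases "n = m")
  case True
  then have "ws = [1..<m+1]" using ws by (simp add: cond_rule_def del: upt_Suc)
  then show ?thesis using True by auto
next
  case False
  then have n: "n > m" using n by simp
  have g: "grown m m H n G" using G by (simp add: cond_state_def)
  show ?thesis
    using ws distinct_choice_possible[OF G n] set_step_law[OF g n]
    by (auto simp: cond_rule_eq[OF n] set_replicate_pmf)
qed

lemma cond_state_step:
  assumes n: "n \<ge> m" and G: "cond_state m H n G" and ws: "ws \<in> set_pmf (cond_rule m \<alpha> (Suc n) G)"
  shows "cond_state m H (Suc n) (attach G (Suc n) ws)"
proof -
  note supp = cond_rule_support[OF G n ws]
  have g: "grown m m H n G" using G by (simp add: cond_state_def)
  have "grown m m H (Suc n) (attach G (Suc n) ws)"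
    using supp by (intro grown_attach g n) auto
  moreover have "{1..m} \<subseteq> set_mset (endpoints (attach G (Suc n) ws))"
  proof (cases "n = m")
    case True
    then have "ws = [1..<m+1]" using ws by (simp add: cond_rule_def del: upt_Suc)
    then show ?thesis by (auto simp: endpoints_attach)
  next
    case False
    then show ?thesis using G n by (auto simp: endpoints_attach cond_state_def)
  qed
  moreover have "deg (attach G (Suc n) ws) k \<le> Suc n + 2 * size H" for k
  proof (cases "k = Suc n")
    case True
    have "deg G k = 0" using g True by (intro deg_eq_0[of _ n]) (auto simp: grown_def)
    moreover have "count (mset ws) k = 0" using supp True by (auto simp: count_eq_zero_iff)
    moreover have "length ws = m" using supp by simp
    ultimately have "deg (attach G (Suc n) ws) k = m"
      unfolding deg_attach by (simp only: True) simp
    then show ?thesis using n by simp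
  next
    case False
    have "count (mset ws) k \<le> 1" using supp by (intro distinct_count_le_1) simp
    moreover have "deg G k \<le> n + 2 * size H" using G by (simp add: cond_state_def)
    ultimately show ?thesis using False by (simp add: deg_attach)
  qed
  ultimately show ?thesis by (simp add: cond_state_def)
qed

lemma cond_state_initial: "cond_state m H m H"
proof -
  have "deg H k \<le> size (endpoints H)" for k by (simp add: deg_def count_le_size)
  then show ?thesis
    using grown_initial[OF H] by (auto simp: cond_state_def size_endpoints intro: trans_le_add2)
qed

lemma law_cond_state:
  assumes "n \<ge> m" "G \<in> set_pmf (grow m H (cond_rule m \<alpha>) n)"
  shows "cond_state m H n G"
  by (rule set_grow_invariant[where P = "cond_state m H" and rule = "cond_rule m \<alpha>", OF _ _ assms])
    (use cond_state_initial cond_state_step in auto)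

sublocale attachment_process m m H "cond_rule m \<alpha>"
proof
  show "length ws = m \<and> set ws \<subseteq> {1..n}"
    if "n \<ge> m" "G \<in> set_pmf (grow m H (cond_rule m \<alpha>) n)" "ws \<in> set_pmf (cond_rule m \<alpha> (Suc n) G)" for n G ws
    using cond_rule_support[OF law_cond_state[OF that(1,2)] that(1,3)] by simp
qed (use m H in auto)

definition sum_squares :: "nat \<Rightarrow> mgraph \<Rightarrow> real" where
  "sum_squares n G = (\<Sum>k\<in>{1..n}. (real (deg G k))\<^sup>2)"

lemma sum_squares_nonneg: "0 \<le> sum_squares n G"
  by (simp add: sum_squares_def sum_nonneg)

lemma deg_le_sqrt_sum_squares: "k \<in> {1..n} \<Longrightarrow> real (deg G k) \<le> sqrt (sum_squares n G)"
  unfolding sum_squares_def by (intro real_le_rsqrt member_le_sum) auto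

lemma sum_deg:
  assumes "grown m m H n G" "n \<ge> m"
  shows "(\<Sum>k\<in>{1..n}. real (deg G k)) = degree_sum n"
proof -
  have sub: "set_mset (endpoints G) \<subseteq> {1..n}" using assms by (intro set_endpoints) (auto simp: grown_def)
  have "(\<Sum>k\<in>{1..n}. deg G k) = (\<Sum>k\<in>set_mset (endpoints G). deg G k)"
    using sub by (intro sum.mono_neutral_right) (auto simp: deg_def count_eq_zero_iff)
  also have "\<dots> = size (endpoints G)" by (simp add: deg_def size_multiset_overloaded_eq)
  finally show ?thesis using size_endpoints_eq[OF assms] by (simp flip: of_nat_sum)
qed

text \<open>
  A vertex of degree \<open>n\<close> is chosen with probability close to \<open>1 / (2 * m)\<close> at most. Any number
  strictly between this value and \<open>1 / (2 * (m - 1))\<close> would do.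
\<close>

definition max_bound :: real where
  "max_bound = 1 / (2 * real m - 1)"

lemma max_bound_pos: "max_bound > 0"
  using m by (simp add: max_bound_def)

lemma eventually_step_law_le: "\<exists>n0>m. \<forall>n\<ge>n0. \<forall>G. cond_state m H n G \<longrightarrow> (\<forall>k. pmf (step_law n G) k \<le> max_bound)"
proof -
  have "(\<lambda>n. 1 / real n + (real n + 2 * size H) / (2 * m * (real n - m))) \<longlonglongrightarrow> inverse (real m) / 2"
    using m by real_asymp
  moreover have "inverse (real m) / 2 < max_bound"
  proof -
    have "1 / (2 * real m) < 1 / (2 * real m - 1)" using m by (intro divide_strict_left_mono) auto
    then show ?thesis by (simp add: max_bound_def inverse_eq_divide)
  qed
  ultimately have "\<forall>\<^sub>F n in sequentially. 1 / real n + (real n + 2 * size H) / (2 * m * (real n - m)) < max_bound"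
    by (rule order_tendstoD)
  then obtain n1 where n1: "\<And>n. n \<ge> n1 \<Longrightarrow> 1 / real n + (real n + 2 * size H) / (2 * m * (real n - m)) < max_bound"
    unfolding eventually_sequentially by blast
  show ?thesis
  proof (intro exI[of _ "max n1 (Suc m)"] conjI allI impI)
    fix n G k assume n: "n \<ge> max n1 (Suc m)" and G: "cond_state m H n G"
    have g: "grown m m H n G" using G by (simp add: cond_state_def)
    have nm: "n > m" using n by simp
    show "pmf (step_law n G) k \<le> max_bound"
    proof (cases "k \<in> {1..n}")
      case True
      have "\<alpha> / n \<le> 1 / n" using \<alpha> by (intro divide_right_mono) auto
      moreover have "(1 - \<alpha>) * deg G k / degree_sum n \<le> (real n + 2 * size H) / (2 * m * (real n - m))"
      proof (rule frac_le)
        have "deg G k \<le> n + 2 * size H" using G by (simp add: cond_state_def)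
        then have "real (deg G k) \<le> real (n + 2 * size H)" by (rule of_nat_mono)
        then have "(1 - \<alpha>) * deg G k \<le> 1 * real (n + 2 * size H)"
          using \<alpha> by (intro mult_mono) auto
        then show "(1 - \<alpha>) * deg G k \<le> real n + 2 * size H" by simp
      qed (use nm m in \<open>auto simp: degree_sum_def\<close>)
      ultimately show ?thesis using n1[of n] n unfolding pmf_step_law[OF g nm True] by simp
    next
      case False
      then have "pmf (step_law n G) k = 0" using set_step_law[OF g nm] by (auto simp: set_pmf_iff)
      then show ?thesis using max_bound_pos by simp
    qed
  qed simp
qed

definition threshold :: nat where
  "threshold = (SOME n0. n0 > m \<and> (\<forall>n\<ge>n0. \<forall>G. cond_state m H n G \<longrightarrow> (\<forall>k. pmf (step_law n G) k \<le> max_bound)))"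

lemma threshold: "threshold > m"
  and step_law_le: "n \<ge> threshold \<Longrightarrow> cond_state m H n G \<Longrightarrow> pmf (step_law n G) k \<le> max_bound"
  using someI_ex[OF eventually_step_law_le] unfolding threshold_def by blast+

lemma prob_distinct_step_law:
  assumes n: "n \<ge> threshold" and G: "cond_state m H n G"
  shows "prob_distinct m (step_law n G) \<ge> (1 / 2) ^ Suc m"
proof -
  have nm: "n > m" using n threshold by simp
  have g: "grown m m H n G" using G by (simp add: cond_state_def)
  note fin = finite_step_law[OF g nm] and le = step_law_le[OF n G]
  have m1: "real (m - 1) * max_bound \<le> 1 / 2" using m by (simp add: max_bound_def of_nat_diff field_simps)
  have "(1 / 2) ^ (m - 1) * (1 / 2) \<le> prob_distinct (m - 1) (step_law n G) * (1 - real (m - 1) * max_bound)"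
    using prob_distinct_half_power[OF fin le m1] m1 prob_distinct_bounds(1)[OF fin le] by (intro mult_mono) auto
  also have "\<dots> \<le> prob_distinct m (step_law n G)"
    using prob_distinct_Suc_ge[OF fin le, of "m - 1"] m by simp
  finally have "(1 / 2) ^ m \<le> prob_distinct m (step_law n G)"
    using m by (cases m) (auto simp: mult_ac)
  then show ?thesis by (rule order_trans[rotated]) simp
qed

text \<open>
  With the crude bound \<open>max_bound\<close>, conditioning multiplies the mean \<open>m * pmf p k\<close> by at most
  \<open>(2 * m - 1) / m\<close>. That this is strictly less than \<open>2\<close> is essential below.
\<close>

lemma expect_cond_count_le:
  assumes n: "n \<ge> threshold" and G: "cond_state m H n G"
  shows "expect (cond_rule m \<alpha> (Suc n) G) (\<lambda>ws. real (count (mset ws) k)) \<le> (2 * real m - 1) * pmf (step_law n G) k"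
proof -
  have nm: "n > m" using n threshold by simp
  have g: "grown m m H n G" using G by (simp add: cond_state_def)
  note fin = finite_step_law[OF g nm] and le = step_law_le[OF n G]
  have "1 - real (m - 1) * max_bound = m / (2 * real m - 1)"
    using m by (simp add: max_bound_def of_nat_diff field_simps)
  moreover from this have "real (m - 1) * max_bound < 1" using m by (simp add: max_bound_def of_nat_diff)
  moreover have "prob_distinct m (step_law n G) > 0"
    using prob_distinct_step_law[OF n G] by (rule less_le_trans[rotated]) simp
  ultimately show ?thesis
    using cond_distinct_count_le[OF fin le distinct_choice_possible[OF G nm], of k] m
    unfolding cond_rule_eq[OF nm] by simp
qed

text \<open>
  Since no vertex gains more than one edge, the sum of squares increases by the sum of \<open>2 * d + 1\<close>
  over the \<open>m\<close> receivers, plus the square of the degree of the new vertex.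
\<close>

lemma expect_sum_squares_step:
  assumes n: "n \<ge> threshold" and G: "cond_state m H n G"
  shows "expect (cond_rule m \<alpha> (Suc n) G) (\<lambda>ws. sum_squares (Suc n) (attach G (Suc n) ws))
    \<le> sum_squares n G * (1 + 2 * (2 * real m - 1) / degree_sum n) + (2 * (2 * real m - 1) * (degree_sum n / n) + m + (real m)\<^sup>2)"
proof -
  have nm: "n > m" using n threshold by simp
  have g: "grown m m H n G" using G by (simp add: cond_state_def)
  let ?W = "cond_rule m \<alpha> (Suc n) G"
  let ?X = "\<lambda>k ws. real (count (mset ws) k)"
  let ?d = "\<lambda>k. real (deg G k)"
  note supp = cond_rule_support[OF G less_imp_le[OF nm]]
  have finW: "finite (set_pmf ?W)"
    by (rule finite_subset[OF _ finite_lists_length_eq[of "{1..n}" m]]) (use supp in auto)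
  have "expect ?W (\<lambda>ws. sum_squares (Suc n) (attach G (Suc n) ws))
      = expect ?W (\<lambda>ws. (\<Sum>k\<in>{1..n}. 2 * ?d k * ?X k ws) + (sum_squares n G + m + (real m)\<^sup>2))"
  proof (rule expect_cong)
    fix ws assume ws: "ws \<in> set_pmf ?W"
    note s = supp[OF ws]
    have d0: "deg (attach G (Suc n) ws) (Suc n) = m"
    proof -
      have "deg G (Suc n) = 0" using g by (intro deg_eq_0[of _ n]) (auto simp: grown_def)
      moreover have "count (mset ws) (Suc n) = 0" using s by (auto simp: count_eq_zero_iff)
      moreover have "length ws = m" using s by simp
      ultimately show ?thesis unfolding deg_attach by (simp only:) simp
    qed
    have "{1..Suc n} = insert (Suc n) {1..n}" by auto
    then have "sum_squares (Suc n) (attach G (Suc n) ws)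
        = (real m)\<^sup>2 + (\<Sum>k\<in>{1..n}. (real (deg (attach G (Suc n) ws) k))\<^sup>2)"
      by (simp add: sum_squares_def d0)
    also have "(\<Sum>k\<in>{1..n}. (real (deg (attach G (Suc n) ws) k))\<^sup>2) = (\<Sum>k\<in>{1..n}. (?d k)\<^sup>2 + 2 * ?d k * ?X k ws + ?X k ws)"
    proof (rule sum.cong)
      fix k assume "k \<in> {1..n}"
      have "count (mset ws) k \<le> 1" using s by (intro distinct_count_le_1) simp
      moreover have "(real x)\<^sup>2 = real x" if "x \<le> 1" for x :: nat
        using that by (auto simp: le_Suc_eq)
      ultimately have "(?X k ws)\<^sup>2 = ?X k ws" by blast
      then show "(real (deg (attach G (Suc n) ws) k))\<^sup>2 = (?d k)\<^sup>2 + 2 * ?d k * ?X k ws + ?X k ws"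
        using \<open>k \<in> {1..n}\<close> by (simp add: deg_attach power2_sum)
    qed simp
    also have "\<dots> = sum_squares n G + (\<Sum>k\<in>{1..n}. 2 * ?d k * ?X k ws) + (\<Sum>k\<in>{1..n}. ?X k ws)"
      by (simp add: sum.distrib sum_squares_def)
    also have "(\<Sum>k\<in>{1..n}. ?X k ws) = m"
    proof -
      have "(\<Sum>k\<in>{1..n}. count (mset ws) k) = (\<Sum>k\<in>set_mset (mset ws). count (mset ws) k)"
        using s by (intro sum.mono_neutral_right) (auto simp: count_eq_zero_iff)
      also have "\<dots> = size (mset ws)" by (simp only: size_multiset_overloaded_eq)
      also have "\<dots> = m" using s by simp
      finally show ?thesis by (simp flip: of_nat_sum)
    qed
    finally show "sum_squares (Suc n) (attach G (Suc n) ws)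
        = (\<Sum>k\<in>{1..n}. 2 * ?d k * ?X k ws) + (sum_squares n G + m + (real m)\<^sup>2)" by simp
  qed
  also have "\<dots> = (\<Sum>k\<in>{1..n}. 2 * ?d k * expect ?W (?X k)) + (sum_squares n G + m + (real m)\<^sup>2)"
    by (simp add: expect_add expect_sum finW)
  also have "(\<Sum>k\<in>{1..n}. 2 * ?d k * expect ?W (?X k))
      \<le> (\<Sum>k\<in>{1..n}. 2 * (2 * real m - 1) * (?d k / n + (?d k)\<^sup>2 / degree_sum n))"
  proof (rule sum_mono)
    fix k assume k: "k \<in> {1..n}"
    have Z: "degree_sum n > 0" by (rule degree_sum_pos[OF nm])
    have "pmf (step_law n G) k \<le> 1 / n + ?d k / degree_sum n"
      unfolding pmf_step_law[OF g nm k] using \<alpha> Z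
      by (intro add_mono divide_right_mono) (auto intro: mult_left_le_one_le)
    then have "(2 * real m - 1) * pmf (step_law n G) k \<le> (2 * real m - 1) * (1 / n + ?d k / degree_sum n)"
      using m by (intro mult_left_mono) auto
    with expect_cond_count_le[OF n G, of k]
    have "expect ?W (?X k) \<le> (2 * real m - 1) * (1 / n + ?d k / degree_sum n)" by linarith
    then have "2 * ?d k * expect ?W (?X k) \<le> 2 * ?d k * ((2 * real m - 1) * (1 / n + ?d k / degree_sum n))"
      by (intro mult_left_mono) auto
    also have "\<dots> = 2 * (2 * real m - 1) * (?d k / n + (?d k)\<^sup>2 / degree_sum n)"
      by (simp add: algebra_simps power2_eq_square)
    finally show "2 * ?d k * expect ?W (?X k) \<le> \<dots>" .
  qed
  also have "(\<Sum>k\<in>{1..n}. 2 * (2 * real m - 1) * (?d k / n + (?d k)\<^sup>2 / degree_sum n))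
      = 2 * (2 * real m - 1) * (degree_sum n / n + sum_squares n G / degree_sum n)"
    unfolding sum_distrib_left[symmetric] sum.distrib sum_divide_distrib[symmetric]
      sum_deg[OF g less_imp_le[OF nm]] sum_squares_def ..
  finally have "expect ?W (\<lambda>ws. sum_squares (Suc n) (attach G (Suc n) ws))
      \<le> 2 * (2 * real m - 1) * (degree_sum n / n + sum_squares n G / degree_sum n) + (sum_squares n G + m + (real m)\<^sup>2)"
    by simp
  moreover have "\<kappa> * (w + s / z) + (s + x + y) = s * (1 + \<kappa> / z) + (\<kappa> * w + x + y)" for s \<kappa> z w x y :: real
    by (simp add: algebra_simps)
  ultimately show ?thesis by metis
qed

text \<open>
  Up to a bounded summand, the expected sum of squares grows per step by a factor of at most
  \<open>1 + (2 - \<eta>) / n\<close>, with \<open>\<eta> = 1 / (2 * m)\<close>, hence more slowly than \<open>n\<^sup>2\<close>. The exponent \<open>2 - \<eta>\<close> lies between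
  \<open>2 - 1 / m\<close>, which comes from the factor \<open>(2 * m - 1) / m\<close> above, and \<open>2\<close>; the room is used to
  replace \<open>n - m\<close> by \<open>n\<close>.
\<close>

lemma expected_sum_squares_tendsto_0: "(\<lambda>n. expect (law n) (sum_squares n) / (real n)\<^sup>2) \<longlonglongrightarrow> 0"
proof -
  define \<eta> where "\<eta> = 1 / (2 * real m)"
  define S where "S n = expect (law n) (sum_squares n)" for n
  define C where "C = 2 * (2 * real m - 1) * (2 * size H + 2 * m) + m + (real m)\<^sup>2"
  have \<eta>: "0 < \<eta>" "\<eta> \<le> 1" using m by (auto simp: \<eta>_def)
  have S0: "S n \<ge> 0" for n unfolding S_def by (intro expect_nonneg sum_squares_nonneg)
  have "\<forall>\<^sub>F n in sequentially. 2 * (2 * real m - 1) / (2 * real m * (real n - m)) \<le> (2 - \<eta>) / n"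
    using eventually_ge_at_top[of "4 * m * m"]
  proof eventually_elim
    case (elim n)
    have n: "real n \<ge> 4 * real m * real m" using of_nat_mono[OF elim, where 'a = real] by simp
    have "4 * real m * 1 \<le> 4 * real m * real m" using m by (intro mult_left_mono) auto
    then have pos: "real n - m > 0" "real n > 0" using n m by linarith+
    have "(2 * (2 * real m - 1)) * (2 * real m * n) \<le> (4 * real m - 1) * (2 * real m * (real n - m))"
    proof -
      have "(2 * real m - 1) * (2 * n) \<le> (4 * real m - 1) * (real n - m)"
        using n m by (simp add: algebra_simps)
      from mult_left_mono[OF this, of "2 * real m"] show ?thesis by (simp add: algebra_simps)
    qed
    then have "2 * (2 * real m - 1) / (2 * real m * (real n - m)) \<le> (4 * real m - 1) / (2 * real m * n)"
    proof -
      have "x / y \<le> z / w" if "x * w \<le> z * y" "y > 0" "w > 0" for x y z w :: real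
        using that by (simp add: divide_le_eq le_divide_eq)
      from this[OF \<open>_ \<le> _ * (2 * real m * (real n - m))\<close>] show ?thesis using pos m by simp
    qed
    also have "\<dots> = (2 - \<eta>) / n" using m pos by (simp add: \<eta>_def field_simps)
    finally show ?case .
  qed
  then have "\<forall>\<^sub>F n in sequentially. S (Suc n) / (real (Suc n))\<^sup>2
      \<le> (1 - \<eta> / (real n + 1)) * (S n / (real n)\<^sup>2) + (C / (real n + 1)) / (real n + 1)"
    using eventually_ge_at_top[of threshold]
  proof eventually_elim
    case (elim n)
    have nm: "n > m" using elim threshold by simp
    then have n0: "real n > 0" by simp
    have Z: "2 * real m * (real n - m) \<le> degree_sum n" "2 * real m * (real n - m) > 0"
      using nm m by (auto simp: degree_sum_def)
    have "2 * (2 * real m - 1) / degree_sum n \<le> 2 * (2 * real m - 1) / (2 * real m * (real n - m))"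
      using Z m by (intro divide_left_mono) auto
    with elim have 1: "2 * (2 * real m - 1) / degree_sum n \<le> (2 - \<eta>) / n" by linarith
    have 2: "degree_sum n / n \<le> 2 * size H + 2 * m"
    proof -
      have "degree_sum n \<le> 2 * real (size H) * 1 + 2 * m * real n" by (simp add: degree_sum_def algebra_simps)
      also have "2 * real (size H) * 1 \<le> 2 * real (size H) * real n" using nm by (intro mult_left_mono) auto
      finally show ?thesis using n0 by (simp add: field_simps)
    qed
    have "S (Suc n) \<le> expect (law n) (\<lambda>G. sum_squares n G * (1 + (2 - \<eta>) / n) + C)"
      unfolding S_def expect_law_Suc[OF less_imp_le[OF nm]]
    proof (rule expect_mono[OF finite_law])
      fix G assume "G \<in> set_pmf (law n)"
      then have G: "cond_state m H n G" by (intro law_cond_state) (use nm in auto)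
      have "2 * (2 * real m - 1) * (degree_sum n / n) \<le> 2 * (2 * real m - 1) * (2 * size H + 2 * m)"
        using 2 m by (intro mult_left_mono) auto
      moreover have "sum_squares n G * (1 + 2 * (2 * real m - 1) / degree_sum n) \<le> sum_squares n G * (1 + (2 - \<eta>) / n)"
        using 1 sum_squares_nonneg by (intro mult_left_mono) auto
      ultimately show "expect (cond_rule m \<alpha> (Suc n) G) (\<lambda>ws. sum_squares (Suc n) (attach G (Suc n) ws))
          \<le> sum_squares n G * (1 + (2 - \<eta>) / n) + C"
        using expect_sum_squares_step[OF elim(2) G] unfolding C_def by linarith
    qed
    also have "\<dots> = S n * (1 + (2 - \<eta>) / n) + C" by (simp add: expect_add finite_law S_def)
    finally have "S (Suc n) / (real n + 1)\<^sup>2 \<le> (S n * (1 + (2 - \<eta>) / n) + C) / (real n + 1)\<^sup>2"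
      by (intro divide_right_mono) auto
    also have "\<dots> = S n / (real n)\<^sup>2 * (((real n)\<^sup>2 + (2 - \<eta>) * n) / (real n + 1)\<^sup>2) + C / (real n + 1)\<^sup>2"
    proof -
      define T where "T = (real n)\<^sup>2 + (2 - \<eta>) * n"
      have "1 + (2 - \<eta>) / n = T / (real n)\<^sup>2"
        using n0 by (simp add: T_def field_simps power2_eq_square)
      then show ?thesis unfolding T_def[symmetric] by (simp add: add_divide_distrib)
    qed
    finally have "S (Suc n) / (real n + 1)\<^sup>2
        \<le> S n / (real n)\<^sup>2 * (((real n)\<^sup>2 + (2 - \<eta>) * n) / (real n + 1)\<^sup>2) + C / (real n + 1)\<^sup>2" .
    moreover have "((real n)\<^sup>2 + (2 - \<eta>) * n) / (real n + 1)\<^sup>2 \<le> 1 - \<eta> / (real n + 1)"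
    proof -
      have "(real n)\<^sup>2 + (2 - \<eta>) * n \<le> (real n + 1 - \<eta>) * (real n + 1)"
        using \<eta> by (simp add: power2_eq_square algebra_simps)
      then have "((real n)\<^sup>2 + (2 - \<eta>) * n) / (real n + 1)\<^sup>2 \<le> (real n + 1 - \<eta>) * (real n + 1) / (real n + 1)\<^sup>2"
        by (intro divide_right_mono) auto
      also have "\<dots> = (real n + 1 - \<eta>) / (real n + 1)" by (simp add: power2_eq_square)
      also have "\<dots> = 1 - \<eta> / (real n + 1)" by (simp add: field_simps)
      finally show ?thesis .
    qed
    then have "S n / (real n)\<^sup>2 * (((real n)\<^sup>2 + (2 - \<eta>) * n) / (real n + 1)\<^sup>2)
        \<le> S n / (real n)\<^sup>2 * (1 - \<eta> / (real n + 1))"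
      using S0 by (intro mult_left_mono) auto
    ultimately have "S (Suc n) / (real n + 1)\<^sup>2
        \<le> (1 - \<eta> / (real n + 1)) * (S n / (real n)\<^sup>2) + C / (real n + 1)\<^sup>2"
      unfolding mult.commute[of "1 - \<eta> / (real n + 1)"] by linarith
    then show ?case by (simp add: power2_eq_square add.commute)
  qed
  then show ?thesis
    unfolding S_def[symmetric]
    by (rule contracting_recursion_tendsto_0[OF \<eta>(1) _ _, rotated 2])
      (use S0 in simp, real_asymp)
qed

text \<open>
  From \<open>n = 2 * m\<close> on, an upper bound for the probability that a single choice falls on the most
  likely receiver, as no degree exceeds the square root of the sum of the squared degrees.
\<close>

definition concentration :: "nat \<Rightarrow> mgraph \<Rightarrow> real" where
  "concentration n G = 1 / n + sqrt (sum_squares n G) / n"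

lemma concentration_nonneg: "0 \<le> concentration n G"
  by (simp add: concentration_def sum_squares_nonneg)

lemma step_law_le_concentration:
  assumes g: "grown m m H n G" and n: "n \<ge> 2 * m"
  shows "pmf (step_law n G) k \<le> concentration n G"
proof (cases "k \<in> {1..n}")
  case True
  have nm: "n > m" using n m by simp
  have "1 * real n \<le> m * (2 * (real n - m))"
    using n m by (intro mult_mono) auto
  then have Z: "real n \<le> degree_sum n" by (simp add: degree_sum_def algebra_simps)
  have "(1 - \<alpha>) * deg G k \<le> 1 * sqrt (sum_squares n G)"
    using \<alpha> deg_le_sqrt_sum_squares[OF True] by (intro mult_mono) auto
  then have "(1 - \<alpha>) * deg G k / degree_sum n \<le> sqrt (sum_squares n G) / n"
    using Z nm \<alpha> by (intro frac_le) (auto simp: sum_squares_nonneg)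
  moreover have "\<alpha> / n \<le> 1 / n" using \<alpha> by (intro divide_right_mono) auto
  ultimately show ?thesis unfolding pmf_step_law[OF g nm True] concentration_def by linarith
next
  case False
  then have "pmf (step_law n G) k = 0" using set_step_law[OF g] n m by (auto simp: set_pmf_iff)
  then show ?thesis by (simp add: concentration_nonneg)
qed

text \<open>
  By the Cauchy-Schwarz inequality the mean of the square root is at most the root of the mean.
\<close>

lemma expected_concentration_tendsto_0: "(\<lambda>n. expect (law n) (concentration n)) \<longlonglongrightarrow> 0"
proof (rule tendsto_sandwich)
  show "\<forall>\<^sub>F n in sequentially. 0 \<le> expect (law n) (concentration n)"
    by (intro always_eventually allI expect_nonneg concentration_nonneg)
  show "\<forall>\<^sub>F n in sequentially. expect (law n) (concentration n)
      \<le> 1 / n + sqrt (expect (law n) (sum_squares n) / (real n)\<^sup>2)"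
  proof (intro always_eventually allI)
    fix n
    define t where "t G = sqrt (sum_squares n G) / n" for G
    define \<mu> where "\<mu> = expect (law n) t"
    have "0 \<le> expect (law n) (\<lambda>G. (t G - \<mu>)\<^sup>2)" by (intro expect_nonneg) simp
    also have "\<dots> = expect (law n) (\<lambda>G. (t G)\<^sup>2 - 2 * \<mu> * t G + \<mu>\<^sup>2)"
      by (intro expect_cong) (simp add: power2_diff)
    also have "\<dots> = expect (law n) (\<lambda>G. (t G)\<^sup>2) - \<mu>\<^sup>2"
      by (simp add: expect_add expect_diff finite_law \<mu>_def power2_eq_square)
    also have "(\<lambda>G. (t G)\<^sup>2) = (\<lambda>G. sum_squares n G / (real n)\<^sup>2)"
      by (simp add: t_def power_divide sum_squares_nonneg fun_eq_iff)
    finally have "\<mu> \<le> sqrt (expect (law n) (sum_squares n) / (real n)\<^sup>2)"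
      by (intro real_le_rsqrt) simp
    moreover have "expect (law n) (concentration n) = 1 / n + \<mu>"
      unfolding concentration_def[abs_def] \<mu>_def t_def by (simp add: expect_add finite_law)
    ultimately show "expect (law n) (concentration n) \<le> 1 / n + sqrt (expect (law n) (sum_squares n) / (real n)\<^sup>2)"
      by simp
  qed
  have "(\<lambda>n. 1 / real n) \<longlonglongrightarrow> 0" by real_asymp
  from tendsto_add[OF this tendsto_real_sqrt[OF expected_sum_squares_tendsto_0]]
  show "(\<lambda>n. 1 / real n + sqrt (expect (law n) (sum_squares n) / (real n)\<^sup>2)) \<longlonglongrightarrow> 0" by simp
qed simp

text \<open>
  Once the bound \<open>max_bound\<close> is in force, distinctness has probability at least \<open>(1 / 2) ^ Suc m\<close>.
  Therefore the conditioned rate differs from the unconditioned one by a multiple of the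
  concentration, and the latter is small in mean. The other error term comes from replacing the sum
  of degrees by \<open>2 * m * n\<close>.
\<close>

lemma rate_cond:
  fixes j :: nat
  defines "K \<equiv> real m * (1 + j) * ((real m)\<^sup>2 * 2 ^ Suc m)"
  assumes n: "n \<ge> threshold" "n \<ge> 2 * m + 2 * m * m" and G: "G \<in> set_pmf (law n)" and k: "k \<in> {1..n}" and d: "deg G k \<le> j"
  shows "\<bar>expect (cond_rule m \<alpha> (Suc n) G) (\<lambda>ws. count (mset ws) k) - attach_rate m \<alpha> (deg G k) / n\<bar>
      \<le> (K * concentration n G + j * (2 * size H + 2 * real m * m) / n) / n"
    and "expect (cond_rule m \<alpha> (Suc n) G) (\<lambda>ws. real (count (mset ws) k) * (real (count (mset ws) k) - 1)) = 0"
proof -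
  have nm: "n > m" using n threshold by simp
  have st: "cond_state m H n G" by (rule law_cond_state) (use nm G in auto)
  have g: "grown m m H n G" using st by (simp add: cond_state_def)
  have n2: "n \<ge> 2 * m" using n by simp
  note fin = finite_step_law[OF g nm] and le = step_law_le_concentration[OF g n2]
  let ?p = "pmf (step_law n G) k" and ?d = "real (deg G k)" and ?Z = "degree_sum n"
  have pk: "?p = \<alpha> / n + (1 - \<alpha>) * ?d / ?Z" by (rule pmf_step_law[OF g nm k])
  have Z: "?Z \<ge> m * real n" "?Z > 0" "real m * n > 0"
  proof -
    have "real m * (2 * real m) \<le> real m * real n" using n2 by (intro mult_left_mono) auto
    then show "?Z \<ge> m * real n" by (simp add: degree_sum_def algebra_simps)
    show "real m * n > 0" using nm m by simp
    then show "?Z > 0" using \<open>?Z \<ge> m * real n\<close> by linarith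
  qed
  have d': "(1 - \<alpha>) * ?d \<le> j" "(1 - \<alpha>) * ?d \<ge> 0"
    using \<alpha> d mult_mono[of "1 - \<alpha>" 1 ?d "real j"] by auto
  have p_le: "?p \<le> (1 + j) / n"
  proof -
    have "real n \<le> m * real n" using m mult_right_mono[of 1 "real m" "real n"] by simp
    then have "real n \<le> ?Z" using Z(1) by linarith
    then have "(1 - \<alpha>) * ?d / ?Z \<le> j / n" using d' nm by (intro frac_le) auto
    moreover have "\<alpha> / n \<le> 1 / n" using \<alpha> by (intro divide_right_mono) auto
    ultimately show ?thesis unfolding pk by (simp add: add_divide_distrib)
  qed
  have approx: "\<bar>m * ?p - attach_rate m \<alpha> (deg G k) / n\<bar> \<le> j * (2 * size H + 2 * real m * m) / n / n"
  proof -
    have "m * ?p - attach_rate m \<alpha> (deg G k) / n = (1 - \<alpha>) * ?d * (2 * m * real n - ?Z) / (?Z * (2 * n))"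
      using Z nm by (simp add: pk attach_rate_def field_simps)
    moreover have "\<bar>(1 - \<alpha>) * ?d * (2 * m * real n - ?Z) / (?Z * (2 * n))\<bar>
        \<le> j * (2 * size H + 2 * real m * m) / (real n * n)"
    proof -
      have "2 * m * real n - ?Z = 2 * real m * m - 2 * size H" by (simp add: degree_sum_def algebra_simps)
      moreover have "\<bar>2 * real m * m - 2 * size H\<bar> \<le> 2 * size H + 2 * real m * m"
      proof -
        have "\<bar>x - y\<bar> \<le> y + x" if "0 \<le> x" "0 \<le> y" for x y :: real
          using that by simp
        from this[of "2 * real m * m" "2 * size H"] show ?thesis by simp
      qed
      ultimately have "\<bar>2 * m * real n - ?Z\<bar> \<le> 2 * size H + 2 * real m * m" by simp
      then have "\<bar>(1 - \<alpha>) * ?d * (2 * m * real n - ?Z)\<bar> \<le> j * (2 * size H + 2 * real m * m)"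
        unfolding abs_mult[of "(1 - \<alpha>) * ?d"] using d' by (intro mult_mono) auto
      moreover have "real n * n \<le> ?Z * (2 * n)"
      proof -
        have "real n \<le> m * real n" using m mult_right_mono[of 1 "real m" "real n"] by simp
        then have "real n \<le> ?Z" using Z(1) by linarith
        then show ?thesis by (intro mult_mono) auto
      qed
      ultimately show ?thesis using nm Z unfolding abs_divide
        by (intro frac_le) auto
    qed
    ultimately show ?thesis by simp
  qed
  have "\<bar>expect (cond_rule m \<alpha> (Suc n) G) (\<lambda>ws. count (mset ws) k) - m * ?p\<bar>
      \<le> m * ?p * ((real m)\<^sup>2 * concentration n G / (1 / 2) ^ Suc m)"
    unfolding cond_rule_eq[OF nm]
    using m by (intro cond_distinct_count_approx[OF fin le distinct_choice_possible[OF st nm] _ prob_distinct_step_law[OF n(1) st]]) auto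
  also have "\<dots> \<le> m * ((1 + j) / n) * ((real m)\<^sup>2 * concentration n G / (1 / 2) ^ Suc m)"
    using p_le concentration_nonneg by (intro mult_right_mono mult_left_mono) auto
  also have "\<dots> = K * concentration n G / n"
    by (simp add: K_def power_divide field_simps)
  finally show "\<bar>expect (cond_rule m \<alpha> (Suc n) G) (\<lambda>ws. count (mset ws) k) - attach_rate m \<alpha> (deg G k) / n\<bar>
      \<le> (K * concentration n G + j * (2 * size H + 2 * real m * m) / n) / n"
    using approx unfolding add_divide_distrib by linarith
  have "expect (cond_rule m \<alpha> (Suc n) G) (\<lambda>ws. real (count (mset ws) k) * (real (count (mset ws) k) - 1))
      = expect (cond_rule m \<alpha> (Suc n) G) (\<lambda>ws. 0)"
  proof (rule expect_cong)
    fix ws assume "ws \<in> set_pmf (cond_rule m \<alpha> (Suc n) G)"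
    then have "distinct ws" using cond_rule_support[OF st] nm by simp
    then have "count (mset ws) k \<le> 1" by (rule distinct_count_le_1)
    then show "real (count (mset ws) k) * (real (count (mset ws) k) - 1) = 0" by (auto simp: le_Suc_eq)
  qed
  then show "expect (cond_rule m \<alpha> (Suc n) G) (\<lambda>ws. real (count (mset ws) k) * (real (count (mset ws) k) - 1)) = 0"
    by simp
qed

end

context conditional_model
begin

lemma expected_degree_count_limit_cond:
  assumes p: "\<And>j. (1 + attach_rate m \<alpha> j) * p j
      = of_bool (j = m) + (if j = 0 then 0 else attach_rate m \<alpha> (j - 1) * p (j - 1))"
  shows "(\<lambda>n. expect (law n) (degree_count n j) / n) \<longlonglongrightarrow> p j"
proof (rule expected_degree_count_limit[OF attach_rate_nonneg p])
  fix j :: nat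
  define K where "K = real m * (1 + j) * ((real m)\<^sup>2 * 2 ^ Suc m)"
  define L where "L = j * (2 * size H + 2 * real m * m)"
  define \<epsilon> where "\<epsilon> n G = K * concentration n G + L / n" for n G
  have \<epsilon>0: "0 \<le> \<epsilon> n G" for n G by (simp add: \<epsilon>_def K_def L_def concentration_nonneg)
  have "expect (law n) (\<epsilon> n) = K * expect (law n) (concentration n) + L / n" for n
    unfolding \<epsilon>_def[abs_def] by (simp add: expect_add finite_law)
  moreover have "(\<lambda>n. L / real n) \<longlonglongrightarrow> 0" by real_asymp
  ultimately have lim: "(\<lambda>n. expect (law n) (\<epsilon> n)) \<longlonglongrightarrow> 0"
    using tendsto_add[OF tendsto_mult[OF tendsto_const[of K] expected_concentration_tendsto_0]] by simp
  have "\<forall>\<^sub>F n in sequentially. \<forall>G\<in>set_pmf (law n). \<forall>k\<in>{1..n}. deg G k \<le> j \<longrightarrow>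
      \<bar>expect (cond_rule m \<alpha> (Suc n) G) (\<lambda>ws. count (mset ws) k) - attach_rate m \<alpha> (deg G k) / n\<bar> \<le> \<epsilon> n G / n \<and>
      expect (cond_rule m \<alpha> (Suc n) G) (\<lambda>ws. real (count (mset ws) k) * (real (count (mset ws) k) - 1)) \<le> \<epsilon> n G / n"
    using eventually_ge_at_top[of threshold] eventually_ge_at_top[of "2 * m + 2 * m * m"]
  proof eventually_elim
    case (elim n)
    show ?case
    proof (intro ballI impI conjI)
      fix G k assume *: "G \<in> set_pmf (law n)" "k \<in> {1..n}" "deg G k \<le> j"
      show "\<bar>expect (cond_rule m \<alpha> (Suc n) G) (\<lambda>ws. count (mset ws) k) - attach_rate m \<alpha> (deg G k) / n\<bar> \<le> \<epsilon> n G / n"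
        using rate_cond(1)[OF elim *] by (simp only: \<epsilon>_def K_def L_def)
      show "expect (cond_rule m \<alpha> (Suc n) G) (\<lambda>ws. real (count (mset ws) k) * (real (count (mset ws) k) - 1)) \<le> \<epsilon> n G / n"
        unfolding rate_cond(2)[OF elim *] using \<epsilon>0[of n G] by simp
    qed
  qed
  with lim \<epsilon>0 show "\<exists>\<epsilon>. (\<forall>n G. 0 \<le> \<epsilon> n G) \<and> (\<lambda>n. expect (law n) (\<epsilon> n)) \<longlonglongrightarrow> 0 \<and>
      (\<forall>\<^sub>F n in sequentially. \<forall>G\<in>set_pmf (law n). \<forall>k\<in>{1..n}. deg G k \<le> j \<longrightarrow>
        \<bar>expect (cond_rule m \<alpha> (Suc n) G) (\<lambda>ws. count (mset ws) k) - attach_rate m \<alpha> (deg G k) / n\<bar> \<le> \<epsilon> n G / n \<and>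
        expect (cond_rule m \<alpha> (Suc n) G) (\<lambda>ws. real (count (mset ws) k) * (real (count (mset ws) k) - 1)) \<le> \<epsilon> n G / n)"
    by blast
qed (use \<alpha> in auto)

end

section \<open>Convergence in the three models\<close>

context attachment_process
begin

lemma degree_laws_converge:
  assumes lim: "\<And>j. (\<lambda>n. expect (law n) (degree_count n j) / n) \<longlonglongrightarrow> pmf P j"
    and P': "\<And>j. pmf P' j = (real j - real m) / m * pmf P j"
    and M: "pa_graph m \<alpha> M = law" "n_initial m M = s"
  shows "converges_in_distribution (degree_law m \<alpha> M) P \<and>
    (\<forall>d. converges_in_distribution (receiver_degree_law m \<alpha> M d) P')"
proof (intro conjI allI converges_in_distributionI)
  show "(\<lambda>n. pmf (degree_law m \<alpha> M n) j) \<longlonglongrightarrow> pmf P j" for j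
    unfolding degree_law_def M by (rule pmf_degree_tendsto[OF lim])
  show "(\<lambda>n. pmf (receiver_degree_law m \<alpha> M d n) j) \<longlonglongrightarrow> pmf P' j" for d j
    unfolding receiver_degree_law_def M P' by (rule pmf_receiver_degree_tendsto[OF lim])
qed

end

text \<open>
  Both \<open>attach_rate m \<alpha> (m + k)\<close> and \<open>1 + attach_rate m \<alpha> (m + k)\<close> are \<open>(1 - \<alpha>) / 2\<close> times a
  shift of \<open>k\<close>, so that the recursion for the limiting proportions is the functional equation of the
  Gamma quotient.
\<close>

lemma degree_limit_recursion:
  fixes \<alpha> b :: real and p :: "nat \<Rightarrow> real" and m :: nat
  defines "b \<equiv> (1 + \<alpha>) / (1 - \<alpha>)"
  defines "p \<equiv> \<lambda>j. if j < m then 0 else degree_limit (m * b) b (j - m)"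
  assumes m: "m \<ge> 1" and \<alpha>: "0 \<le> \<alpha>" "\<alpha> < 1"
  shows "(1 + attach_rate m \<alpha> j) * p j
    = of_bool (j = m) + (if j = 0 then 0 else attach_rate m \<alpha> (j - 1) * p (j - 1))"
proof -
  have b: "b > 0" and a: "m * b > 0" using m \<alpha> by (auto simp: b_def)
  have rate: "attach_rate m \<alpha> (m + k) = (1 - \<alpha>) / 2 * (real k + m * b)"
    "1 + attach_rate m \<alpha> (m + k) = (1 - \<alpha>) / 2 * (m * b + b + real k + 1)" for k
  proof -
    have \<alpha>b: "(1 - \<alpha>) * b = 1 + \<alpha>" using \<alpha> by (simp add: b_def)
    have split: "(1 - \<alpha>) / 2 * (real k + m * b) = ((1 - \<alpha>) * k + m * ((1 - \<alpha>) * b)) / 2"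
      "(1 - \<alpha>) / 2 * (m * b + b + real k + 1) = (m * ((1 - \<alpha>) * b) + (1 - \<alpha>) * b + (1 - \<alpha>) * k + (1 - \<alpha>)) / 2"
      by (simp_all add: field_simps)
    then show "attach_rate m \<alpha> (m + k) = (1 - \<alpha>) / 2 * (real k + m * b)"
      "1 + attach_rate m \<alpha> (m + k) = (1 - \<alpha>) / 2 * (m * b + b + real k + 1)"
      unfolding split \<alpha>b attach_rate_def by (simp_all add: field_simps)
  qed
  consider "j < m" | "j = m" | k where "j = m + Suc k"
    by (metis less_iff_Suc_add linorder_neqE_nat add_Suc_right)
  then show ?thesis
  proof cases
    case 2
    have "(1 + attach_rate m \<alpha> m) * degree_limit (m * b) b 0
        = (1 - \<alpha>) / 2 * ((m * b + b + 1) * degree_limit (m * b) b 0)"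
      using rate(2)[of 0] by simp
    also have "\<dots> = (1 - \<alpha>) / 2 * (b + 1)" by (simp only: degree_limit_0[OF a b])
    also have "\<dots> = 1" using \<alpha> by (simp add: b_def field_simps)
    finally show ?thesis using 2 m by (simp add: p_def)
  next
    case 3
    have "(1 + attach_rate m \<alpha> j) * p j
        = (1 - \<alpha>) / 2 * ((m * b + b + real k + 2) * degree_limit (m * b) b (Suc k))"
      using rate(2)[of "Suc k"] by (simp add: 3 p_def add_ac)
    also have "\<dots> = (1 - \<alpha>) / 2 * (real k + m * b) * degree_limit (m * b) b k"
      by (simp only: degree_limit_Suc[OF a b] mult.assoc)
    also have "\<dots> = attach_rate m \<alpha> (j - 1) * p (j - 1)"
      using rate(1)[of k] by (simp add: 3 p_def)
    finally show ?thesis using 3 by simp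
  qed (auto simp: p_def)
qed

lemma degree_limit_asymptotics:
  assumes a: "a > 0" and b: "b > 0"
  shows "\<exists>C r. r \<in> O(\<lambda>k. 1 / real k) \<and> (\<forall>k\<ge>1. degree_limit a b k = C * real k powr (- 2 - b) * (1 + r k))"
proof -
  obtain C r where r: "r \<in> O(\<lambda>k. 1 / real k)"
    and eq: "\<And>k. k \<ge> 1 \<Longrightarrow> Gamma (real k + a) / Gamma (real k + (a + b + 2)) = C * real k powr (a - (a + b + 2)) * (1 + r k)"
    using Gamma_quotient_asymptotics[of a "a + b + 2"] a b by auto
  have "degree_limit a b k = ((b + 1) * (Gamma (a + b + 1) / Gamma a) * C) * real k powr (- 2 - b) * (1 + r k)" if "k \<ge> 1" for k
  proof -
    have "a - (a + b + 2) = - 2 - b" "a + b + real k + 2 = real k + (a + b + 2)" by simp_all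
    then show ?thesis using eq[OF that] unfolding degree_limit_def by (simp only: mult.assoc)
  qed
  with r show ?thesis by blast
qed

text \<open>
  The additional factor \<open>k + 1 = k * (1 + 1 / k)\<close> raises the exponent by one and is absorbed in the
  error term.
\<close>

lemma receiver_limit_asymptotics:
  assumes a: "a > 0" and b: "b > 0"
  shows "\<exists>C r. r \<in> O(\<lambda>k. 1 / real k) \<and> (\<forall>k\<ge>1. receiver_limit a b k = C * real k powr (- 1 - b) * (1 + r k))"
proof -
  obtain C r where r: "r \<in> O(\<lambda>k. 1 / real k)"
    and eq: "\<And>k. k \<ge> 1 \<Longrightarrow> Gamma (real k + (a + 1)) / Gamma (real k + (a + b + 3)) = C * real k powr (a + 1 - (a + b + 3)) * (1 + r k)"
    using Gamma_quotient_asymptotics[of "a + 1" "a + b + 3"] a b by auto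
  define B where "B = b * (b + 1) * (Gamma (a + b + 1) / Gamma (a + 1))"
  define r' where "r' k = r k + 1 / real k + r k * (1 / real k)" for k
  have "(\<lambda>k. 1 / real k) \<in> O(\<lambda>_. 1)" by real_asymp
  from landau_o.big.mult[OF r this] have "(\<lambda>k. r k * (1 / real k)) \<in> O(\<lambda>k. 1 / real k)" by simp
  then have "r' \<in> O(\<lambda>k. 1 / real k)"
    unfolding r'_def using r by (intro sum_in_bigo) auto
  moreover have "receiver_limit a b k = (B * C) * real k powr (- 1 - b) * (1 + r' k)" if k: "k \<ge> 1" for k
  proof -
    have k0: "real k > 0" using k by simp
    have e: "a + 1 - (a + b + 3) = - 1 - b - 1" "a + b + real k + 3 = real k + (a + b + 3)"
      "real k + a + 1 = real k + (a + 1)" by simp_all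
    have "receiver_limit a b k = B * ((real k + 1) * (Gamma (real k + (a + 1)) / Gamma (real k + (a + b + 3))))"
      unfolding receiver_limit_def B_def e(2,3) by simp
    also have "\<dots> = B * ((real k + 1) * (C * real k powr (- 1 - b - 1) * (1 + r k)))"
      unfolding eq[OF k] e(1) ..
    also have "real k powr (- 1 - b - 1) = real k powr (- 1 - b) / real k"
      unfolding powr_diff[of "real k" "- 1 - b" 1] using k0 by simp
    also have "B * ((real k + 1) * (C * (real k powr (- 1 - b) / real k) * (1 + r k)))
        = (B * C) * real k powr (- 1 - b) * (((real k + 1) / real k) * (1 + r k))"
      by simp
    also have "((real k + 1) / real k) * (1 + r k) = 1 + r' k"
      using k0 by (simp add: r'_def field_simps)
    finally show ?thesis .
  qed
  ultimately show ?thesis by blast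
qed

theorem lemma5p2:
  fixes m :: nat and \<alpha> u \<psi> a :: real
  assumes "m \<ge> 2" and "0 \<le> \<alpha>" and "\<alpha> < 1"
    and "u = \<alpha> / (1 - \<alpha>)"
    and "\<psi> = 1 / (1 + 2 * u)"
    and "a = real m + 2 * real m * u"
  shows "\<exists>P P' :: nat pmf.
    (\<forall>k. pmf P (m + k) =
        (\<psi> + 1) / \<psi> * (Gamma (a + 1 / \<psi> + 1) / Gamma a)
          * (Gamma (real k + a) / Gamma (a + 1 / \<psi> + real k + 2))) \<and>
    (\<forall>k. pmf P' (m + 1 + k) =
        (\<psi> + 1) / \<psi>\<^sup>2 * (Gamma (a + 1 / \<psi> + 1) / Gamma (a + 1))
          * ((real k + 1) * Gamma (real k + a + 1) / Gamma (a + 1 / \<psi> + real k + 3))) \<and>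
    (\<forall>M. valid_model m M \<longrightarrow>
        converges_in_distribution (degree_law m \<alpha> M) P \<and>
        (\<forall>d\<^sub>0. converges_in_distribution (receiver_degree_law m \<alpha> M d\<^sub>0) P')) \<and>
    (\<exists>C r. r \<in> O(\<lambda>k. 1 / real k) \<and>
        (\<forall>k\<ge>1. pmf P (m + k) = C * real k powr (- 2 - 1 / \<psi>) * (1 + r k))) \<and>
    (\<exists>C' r'. r' \<in> O(\<lambda>k. 1 / real k) \<and>
        (\<forall>k\<ge>1. pmf P' (m + 1 + k) = C' * real k powr (- 1 - 1 / \<psi>) * (1 + r' k)))"
proof -
  note m = \<open>m \<ge> 2\<close> and \<alpha> = \<open>0 \<le> \<alpha>\<close> \<open>\<alpha> < 1\<close>
  define b where "b = (1 + \<alpha>) / (1 - \<alpha>)"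
  have b: "b > 0" using \<alpha> by (simp add: b_def)
  have b_u: "1 + 2 * u = b" using \<alpha> assms(4) by (simp add: b_def field_simps)
  have \<psi>: "1 / \<psi> = b" "(\<psi> + 1) / \<psi> = b + 1" "(\<psi> + 1) / \<psi>\<^sup>2 = b * (b + 1)"
    using b unfolding assms(5) b_u by (simp_all add: field_simps power2_eq_square)
  have "m * (1 + 2 * u) = a" using assms(6) by (simp add: algebra_simps)
  then have a_eq: "m * b = a" by (simp only: b_u)
  then have a: "a > 0" using b m by (metis mult_pos_pos of_nat_0_less_iff less_le_trans zero_less_numeral)
  obtain P where P0: "\<And>j. j < m \<Longrightarrow> pmf P j = 0" and P: "\<And>k. pmf P (m + k) = degree_limit a b k"
    using pmf_of_sums_1[OF degree_limit_nonneg[OF a b] degree_limit_sums[OF a b]] by blast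
  obtain P' where P'0: "\<And>j. j < m + 1 \<Longrightarrow> pmf P' j = 0" and P': "\<And>k. pmf P' (m + 1 + k) = receiver_limit a b k"
    using pmf_of_sums_1[OF receiver_limit_nonneg[OF a b] receiver_limit_sums[OF a b]] by blast
  have P'P: "pmf P' j = (real j - real m) / m * pmf P j" for j
  proof -
    consider "j < m" | "j = m" | k where "j = m + 1 + k"
      by (metis less_iff_Suc_add linorder_neqE_nat add_Suc_right add_Suc Suc_eq_plus1)
    then show ?thesis
    proof cases
      case 3
      have "pmf P' j = b * (real k + 1) / a * degree_limit a b (Suc k)"
        unfolding 3 P' by (rule receiver_limit_conv[OF a b])
      also have "degree_limit a b (Suc k) = pmf P j" using P[of "Suc k"] by (simp add: 3)
      also have "b * (real k + 1) / a = (real j - real m) / m"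
        using b m by (simp add: 3 a_eq[symmetric])
      finally show ?thesis .
    qed (use P0 P'0 in auto)
  qed
  have rec: "(1 + attach_rate m \<alpha> j) * pmf P j
      = of_bool (j = m) + (if j = 0 then 0 else attach_rate m \<alpha> (j - 1) * pmf P (j - 1))" for j
  proof -
    have p: "pmf P j = (if j < m then 0 else degree_limit (m * b) b (j - m))" for j
      using P0[of j] P[of "j - m"] by (auto simp: a_eq)
    show ?thesis unfolding p b_def using m \<alpha> by (intro degree_limit_recursion) auto
  qed
  have rate: "0 \<le> attach_rate m \<alpha> j" for j using \<alpha> by (intro attach_rate_nonneg) auto
  have conv: "converges_in_distribution (degree_law m \<alpha> M) P \<and>
      (\<forall>d. converges_in_distribution (receiver_degree_law m \<alpha> M d) P')" if M: "valid_model m M" for M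
  proof (cases M)
    case Independent
    interpret attachment_process m 1 "{#}" "indep_rule m \<alpha>"
      using m by (intro attachment_process_indep) simp
    have "(\<lambda>n. expect (law n) (degree_count n j) / n) \<longlonglongrightarrow> pmf P j" for j
    proof (rule expected_degree_count_limit_of_rate[OF rate rec])
      fix j :: nat
      show "\<exists>K n0. \<forall>n\<ge>n0. \<forall>G\<in>set_pmf (law n). \<forall>k\<in>{1..n}. deg G k \<le> j \<longrightarrow>
        \<bar>expect (indep_rule m \<alpha> (Suc n) G) (\<lambda>ws. count (mset ws) k) - attach_rate m \<alpha> (deg G k) / n\<bar> \<le> K / (real n)\<^sup>2 \<and>
        expect (indep_rule m \<alpha> (Suc n) G) (\<lambda>ws. real (count (mset ws) k) * (real (count (mset ws) k) - 1)) \<le> K / (real n)\<^sup>2"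
        using m \<alpha> law_grown
        by (intro exI[of _ "real j + (m * (1 + real j))\<^sup>2"] exI[of _ 2] allI impI ballI conjI rate_indep) auto
    qed
    then show ?thesis by (rule degree_laws_converge) (use P'P Independent in auto)
  next
    case Sequential
    interpret attachment_process m 1 "{#}" "seq_rule m \<alpha>"
      using m by (intro attachment_process_seq) simp
    have "(\<lambda>n. expect (law n) (degree_count n j) / n) \<longlonglongrightarrow> pmf P j" for j
    proof (rule expected_degree_count_limit_of_rate[OF rate rec])
      fix j :: nat
      show "\<exists>K n0. \<forall>n\<ge>n0. \<forall>G\<in>set_pmf (law n). \<forall>k\<in>{1..n}. deg G k \<le> j \<longrightarrow>
        \<bar>expect (seq_rule m \<alpha> (Suc n) G) (\<lambda>ws. count (mset ws) k) - attach_rate m \<alpha> (deg G k) / n\<bar> \<le> K / (real n)\<^sup>2 \<and>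
        expect (seq_rule m \<alpha> (Suc n) G) (\<lambda>ws. real (count (mset ws) k) * (real (count (mset ws) k) - 1)) \<le> K / (real n)\<^sup>2"
        by (intro exI[of _ "seq_error m j"] exI[of _ 2] allI impI ballI conjI rate_seq) (use m \<alpha> law_grown in auto)
    qed
    then show ?thesis by (rule degree_laws_converge) (use P'P Sequential in auto)
  next
    case (Conditional H)
    interpret conditional_model m \<alpha> H
      using m \<alpha> M Conditional by unfold_locales auto
    show ?thesis
      by (rule degree_laws_converge[OF expected_degree_count_limit_cond[OF rec] P'P]) (use Conditional in auto)
  qed
  have formula: "pmf P (m + k) = (\<psi> + 1) / \<psi> * (Gamma (a + 1 / \<psi> + 1) / Gamma a)
      * (Gamma (real k + a) / Gamma (a + 1 / \<psi> + real k + 2))" for k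
    unfolding P degree_limit_def \<psi> ..
  have formula': "pmf P' (m + 1 + k) = (\<psi> + 1) / \<psi>\<^sup>2 * (Gamma (a + 1 / \<psi> + 1) / Gamma (a + 1))
      * ((real k + 1) * Gamma (real k + a + 1) / Gamma (a + 1 / \<psi> + real k + 3))" for k
    unfolding P' receiver_limit_def \<psi> ..
  have asym: "\<exists>C r. r \<in> O(\<lambda>k. 1 / real k) \<and>
        (\<forall>k\<ge>1. pmf P (m + k) = C * real k powr (- 2 - 1 / \<psi>) * (1 + r k))"
    unfolding P \<psi> by (rule degree_limit_asymptotics[OF a b])
  have asym': "\<exists>C' r'. r' \<in> O(\<lambda>k. 1 / real k) \<and>
        (\<forall>k\<ge>1. pmf P' (m + 1 + k) = C' * real k powr (- 1 - 1 / \<psi>) * (1 + r' k))"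
    unfolding P' \<psi> by (rule receiver_limit_asymptotics[OF a b])
  show ?thesis
    using formula formula' conv asym asym' by blast
qed

end
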